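(* Let $\alpha\equiv\{\alpha_n\}_{n=0}^{\infty}$ be a weight sequence, let $\ell\geq 1$ be an integer and let $k\ge 1$ be an integer. (a) $W_\alpha^{\ell}$ is $k$-hyponormal if and only if $W_{\alpha(\ell:i)}$ is $k$-hyponormal for every $0\le i\le \ell-1$. (b) $W_\alpha^{\ell}$ is subnormal if and only if $W_{\alpha(\ell:i)}$ is subnormal for every $0\le i\le \ell-1$.
   Context: A weight sequence is a bounded sequence of positive numbers $\alpha=\{\alpha_n\}_{n=0}^\infty$; the associated (unilateral) weighted shift $W_\alpha$ is the bounded operator on $\ell^2(\mathbf{Z}_+)$ with $W_\alpha e_n:=\alpha_n e_{n+1}$ ($n\ge 0$), where $\{e_n\}_{n\ge0}$ is the canonical orthonormal basis. For integers $\ell\ge1$ and $0\le i\le \ell-1$, $\alpha(\ell:i)$ denotes the weight sequence $\{\prod_{m=0}^{\ell-1}\alpha_{\ell j+i+m}\}_{j=0}^\infty$ (products of weights in adjacent packets of size $\ell$, beginning with $\alpha_i\cdots\alpha_{i+\ell-1}$). A bounded operator $T$ on a Hilbert space is subnormal if it is the restriction of a normal operator (on a possibly larger Hilbert space) to an invariant subspace. With $[A,B]:=AB-BA$, $T$ is $k$-hyponormal if the $k\times k$ operator matrix $([T^{*j},T^i])_{i,j=1}^k$ is positive (semidefinite), equivalently if the $(k+1)\times(k+1)$ operator matrix $(T^{*j}T^i)_{i,j=0}^k$ is positive (semidefinite). *)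

theory Defs
  imports Complex_Main
begin

section \<open>Complex Hilbert spaces on explicit carriers\<close>

text \<open>
  Subnormality quantifies existentially over Hilbert spaces, so Hilbert spaces are values
  (a carrier together with its operations) and not instances of a type class. The inner product
  is linear in its first argument. Operators are total functions on the underlying type, of which
  only the values on the carrier matter.
\<close>

record 'a hspace =
  hcarrier :: "'a set"
  hzero :: 'a
  hadd :: "'a \<Rightarrow> 'a \<Rightarrow> 'a"
  hscale :: "complex \<Rightarrow> 'a \<Rightarrow> 'a"
  hinner :: "'a \<Rightarrow> 'a \<Rightarrow> complex"

definition hdiff :: "'a hspace \<Rightarrow> 'a \<Rightarrow> 'a \<Rightarrow> 'a" where
  "hdiff H x y = hadd H x (hscale H (- 1) y)"

definition hnorm :: "'a hspace \<Rightarrow> 'a \<Rightarrow> real" where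
  "hnorm H x = sqrt (Re (hinner H x x))"

locale hilbert_space =
  fixes H :: "'a hspace"
  assumes zero_closed: "hzero H \<in> hcarrier H"
    and add_closed: "\<lbrakk>x \<in> hcarrier H; y \<in> hcarrier H\<rbrakk> \<Longrightarrow> hadd H x y \<in> hcarrier H"
    and scale_closed: "x \<in> hcarrier H \<Longrightarrow> hscale H a x \<in> hcarrier H"
    and add_assoc: "\<lbrakk>x \<in> hcarrier H; y \<in> hcarrier H; z \<in> hcarrier H\<rbrakk>
      \<Longrightarrow> hadd H (hadd H x y) z = hadd H x (hadd H y z)"
    and add_commute: "\<lbrakk>x \<in> hcarrier H; y \<in> hcarrier H\<rbrakk> \<Longrightarrow> hadd H x y = hadd H y x"
    and add_zero: "x \<in> hcarrier H \<Longrightarrow> hadd H x (hzero H) = x"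
    and add_inverse: "x \<in> hcarrier H \<Longrightarrow> \<exists>y\<in>hcarrier H. hadd H x y = hzero H"
    and scale_add_right: "\<lbrakk>x \<in> hcarrier H; y \<in> hcarrier H\<rbrakk>
      \<Longrightarrow> hscale H a (hadd H x y) = hadd H (hscale H a x) (hscale H a y)"
    and scale_add_left: "x \<in> hcarrier H
      \<Longrightarrow> hscale H (a + b) x = hadd H (hscale H a x) (hscale H b x)"
    and scale_scale: "x \<in> hcarrier H \<Longrightarrow> hscale H a (hscale H b x) = hscale H (a * b) x"
    and scale_one: "x \<in> hcarrier H \<Longrightarrow> hscale H 1 x = x"
    and inner_add_left: "\<lbrakk>x \<in> hcarrier H; y \<in> hcarrier H; z \<in> hcarrier H\<rbrakk>
      \<Longrightarrow> hinner H (hadd H x y) z = hinner H x z + hinner H y z"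
    and inner_scale_left: "\<lbrakk>x \<in> hcarrier H; y \<in> hcarrier H\<rbrakk>
      \<Longrightarrow> hinner H (hscale H a x) y = a * hinner H x y"
    and inner_commute: "\<lbrakk>x \<in> hcarrier H; y \<in> hcarrier H\<rbrakk>
      \<Longrightarrow> hinner H x y = cnj (hinner H y x)"
    and inner_nonneg: "x \<in> hcarrier H \<Longrightarrow> 0 \<le> Re (hinner H x x)"
    and inner_definite: "\<lbrakk>x \<in> hcarrier H; hinner H x x = 0\<rbrakk> \<Longrightarrow> x = hzero H"
    and complete:
      "\<lbrakk>\<And>n. X n \<in> hcarrier H;
        \<And>e. 0 < e \<Longrightarrow> \<exists>M::nat. \<forall>m\<ge>M. \<forall>n\<ge>M. hnorm H (hdiff H (X m) (X n)) < e\<rbrakk>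
      \<Longrightarrow> \<exists>L\<in>hcarrier H. (\<lambda>n. hnorm H (hdiff H (X n) L)) \<longlonglongrightarrow> 0"


section \<open>Operators\<close>

definition bounded_operator :: "'a hspace \<Rightarrow> ('a \<Rightarrow> 'a) \<Rightarrow> bool" where
  "bounded_operator H T \<longleftrightarrow>
     (\<forall>x\<in>hcarrier H. T x \<in> hcarrier H) \<and>
     (\<forall>x\<in>hcarrier H. \<forall>y\<in>hcarrier H. T (hadd H x y) = hadd H (T x) (T y)) \<and>
     (\<forall>a. \<forall>x\<in>hcarrier H. T (hscale H a x) = hscale H a (T x)) \<and>
     (\<exists>M. \<forall>x\<in>hcarrier H. hnorm H (T x) \<le> M * hnorm H x)"

definition adjoint_op :: "'a hspace \<Rightarrow> ('a \<Rightarrow> 'a) \<Rightarrow> 'a \<Rightarrow> 'a" where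
  "adjoint_op H T y =
     (THE z. z \<in> hcarrier H \<and> (\<forall>x\<in>hcarrier H. hinner H (T x) y = hinner H x z))"

definition commutator :: "'a hspace \<Rightarrow> ('a \<Rightarrow> 'a) \<Rightarrow> ('a \<Rightarrow> 'a) \<Rightarrow> 'a \<Rightarrow> 'a" where
  "commutator H A B x = hdiff H (A (B x)) (B (A x))"

definition normal_operator :: "'a hspace \<Rightarrow> ('a \<Rightarrow> 'a) \<Rightarrow> bool" where
  "normal_operator H N \<longleftrightarrow>
     bounded_operator H N \<and>
     (\<forall>x\<in>hcarrier H. adjoint_op H N (N x) = N (adjoint_op H N x))"

text \<open>
  The matrix \<open>(A i j)\<close>, with \<open>i\<close> and \<open>j\<close> in \<open>I\<close>, acts on families \<open>x\<close> in the direct sum of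
  copies of \<open>H\<close> by \<open>(A x) i = (\<Sum>j\<in>I. A i j (x j))\<close>; the sum below is the inner product of
  \<open>A x\<close> with \<open>x\<close> in that direct sum.
\<close>

definition positive_operator_matrix ::
  "'a hspace \<Rightarrow> nat set \<Rightarrow> (nat \<Rightarrow> nat \<Rightarrow> 'a \<Rightarrow> 'a) \<Rightarrow> bool" where
  "positive_operator_matrix H I A \<longleftrightarrow>
     (\<forall>x. (\<forall>i\<in>I. x i \<in> hcarrier H) \<longrightarrow>
        (\<Sum>i\<in>I. \<Sum>j\<in>I. hinner H (A i j (x j)) (x i)) \<in> \<real> \<and>
        0 \<le> Re (\<Sum>i\<in>I. \<Sum>j\<in>I. hinner H (A i j (x j)) (x i)))"

definition k_hyponormal :: "'a hspace \<Rightarrow> nat \<Rightarrow> ('a \<Rightarrow> 'a) \<Rightarrow> bool" where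
  "k_hyponormal H k T \<longleftrightarrow>
     bounded_operator H T \<and>
     positive_operator_matrix H {1..k} (\<lambda>i j. commutator H (adjoint_op H T ^^ j) (T ^^ i))"

definition linear_isometry :: "'a hspace \<Rightarrow> 'b hspace \<Rightarrow> ('a \<Rightarrow> 'b) \<Rightarrow> bool" where
  "linear_isometry H K V \<longleftrightarrow>
     (\<forall>x\<in>hcarrier H. V x \<in> hcarrier K) \<and>
     (\<forall>x\<in>hcarrier H. \<forall>y\<in>hcarrier H. V (hadd H x y) = hadd K (V x) (V y)) \<and>
     (\<forall>a. \<forall>x\<in>hcarrier H. V (hscale H a x) = hscale K a (V x)) \<and>
     (\<forall>x\<in>hcarrier H. \<forall>y\<in>hcarrier H. hinner K (V x) (V y) = hinner H x y)"

text \<open>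
  \<open>T\<close> is the restriction of a normal operator \<open>N\<close> on a Hilbert space \<open>K\<close> to the invariant subspace
  \<open>H\<close>, where \<open>H\<close> is identified with its image in \<open>K\<close> under a linear isometry \<open>V\<close>; invariance of
  that image is contained in the last equation. HOL cannot quantify over types inside a formula, so
  the type \<open>'b\<close> in which the carrier of \<open>K\<close> may be chosen is a parameter. The predicate is monotone
  in the size of \<open>'b\<close>, and once \<open>'b\<close> is at least as large as the minimal normal extension (for
  separable \<open>H\<close>: of cardinality at least the continuum) it does not depend on \<open>'b\<close>.
\<close>

definition subnormal :: "'b itself \<Rightarrow> 'a hspace \<Rightarrow> ('a \<Rightarrow> 'a) \<Rightarrow> bool" where
  "subnormal (_ :: 'b itself) H T \<longleftrightarrow>
     bounded_operator H T \<and>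
     (\<exists>(K :: 'b hspace) V N.
        hilbert_space K \<and> linear_isometry H K V \<and> normal_operator K N \<and>
        (\<forall>x\<in>hcarrier H. N (V x) = V (T x)))"


section \<open>Weighted shifts\<close>

definition ell2 :: "(nat \<Rightarrow> complex) hspace" where
  "ell2 = \<lparr>hcarrier = {x. summable (\<lambda>n. (cmod (x n))\<^sup>2)},
           hzero = (\<lambda>n. 0),
           hadd = (\<lambda>x y n. x n + y n),
           hscale = (\<lambda>a x n. a * x n),
           hinner = (\<lambda>x y. \<Sum>n. x n * cnj (y n))\<rparr>"

definition weight_sequence :: "(nat \<Rightarrow> real) \<Rightarrow> bool" where
  "weight_sequence \<alpha> \<longleftrightarrow> (\<forall>n. 0 < \<alpha> n) \<and> Bseq \<alpha>"

definition weighted_shift :: "(nat \<Rightarrow> real) \<Rightarrow> (nat \<Rightarrow> complex) \<Rightarrow> nat \<Rightarrow> complex" where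
  "weighted_shift \<alpha> x n = (case n of 0 \<Rightarrow> 0 | Suc m \<Rightarrow> of_real (\<alpha> m) * x m)"

lemma weighted_shift_basis:
  "weighted_shift \<alpha> (\<lambda>j. if j = n then 1 else 0) =
     (\<lambda>j. of_real (\<alpha> n) * (if j = Suc n then 1 else 0))"
  by (auto simp: weighted_shift_def fun_eq_iff split: nat.split)

definition packet_weights :: "(nat \<Rightarrow> real) \<Rightarrow> nat \<Rightarrow> nat \<Rightarrow> nat \<Rightarrow> real" where
  "packet_weights \<alpha> l i j = (\<Prod>m<l. \<alpha> (l * j + i + m))"

end

theory Submission
  imports Defs
begin

text \<open>
  Let \<open>W\<close> be the weighted shift. Since \<open>W ^^ l\<close> moves the entry at position \<open>n\<close> to position
  \<open>n + l\<close>, it preserves residue classes modulo \<open>l\<close>. The splitting of \<open>\<ell>\<^sup>2\<close> into the \<open>l\<close>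
  subspaces of sequences supported in one residue class is orthogonal, each of them is a copy of
  \<open>\<ell>\<^sup>2\<close>, and on the class of \<open>i\<close> the power \<open>W ^^ l\<close> acts as the shift whose weights are the
  packets beginning at position \<open>i\<close> (\<open>subsequence_weighted_shift_funpow\<close>). Hence \<open>W ^^ l\<close> is the
  orthogonal sum of these shifts, and both equivalences are instances of facts about an orthogonal
  sum \<open>T\<close> of operators \<open>D p\<close>.

  For \<open>k\<close>-hyponormality, powers, adjoints and commutators are formed summand by summand, so the
  quadratic form that has to be positive is the sum of the forms of the \<open>D p\<close>
  (\<open>k_hyponormal_diagonal_iff\<close>). That adjoints behave so rests on their existence, which is the
  Riesz representation theorem.

  For subnormality, a normal extension of \<open>T\<close> also extends every \<open>D p\<close>; conversely the sum of
  normal extensions of the \<open>D p\<close> is a normal extension of \<open>T\<close> (\<open>subnormal_diagonal_iff\<close>). The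
  extensions of the \<open>D p\<close> have their elements in a prescribed type, and so must their sum. If the
  type is infinite, it is in bijection with its square, hence tuples of its elements can be encoded
  by single elements (\<open>ex_orthogonal_sum\<close>). If it is finite, it contains no isometric image of
  \<open>\<ell>\<^sup>2\<close>, and both sides of the equivalence fail (\<open>infinite_UNIV_of_subnormal\<close>).
\<close>

section \<open>Inner product calculus and the Riesz representation theorem\<close>

lemma discriminant_nonpos:
  fixes a b c :: real
  assumes nonneg: "\<And>t. 0 \<le> a + 2 * t * b + t\<^sup>2 * c" and "0 \<le> c"
  shows "b\<^sup>2 \<le> a * c"
proof (cases "c = 0")
  case True
  have "b = 0"
  proof (rule ccontr)
    assume "b \<noteq> 0"
    then have "a + 2 * (- (a + 1) / (2 * b)) * b = - 1"
      by (simp add: field_simps)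
    with nonneg[of "- (a + 1) / (2 * b)"] True show False
      by simp
  qed
  with True show ?thesis by simp
next
  case False
  with \<open>0 \<le> c\<close> have c: "0 < c" by simp
  have "a + 2 * (- b / c) * b + (- b / c)\<^sup>2 * c = a - b\<^sup>2 / c"
    using c by (simp add: field_simps power2_eq_square)
  with nonneg[of "- b / c"] have "b\<^sup>2 / c \<le> a"
    by simp
  with c show ?thesis by (simp add: field_simps)
qed

context hilbert_space
begin

declare zero_closed [simp] add_closed [simp] scale_closed [simp]

lemma inner_add_right:
  assumes "x \<in> hcarrier H" "y \<in> hcarrier H" "z \<in> hcarrier H"
  shows "hinner H x (hadd H y z) = hinner H x y + hinner H x z"
  using assms inner_commute[of x "hadd H y z"] inner_commute[of x y] inner_commute[of x z]
  by (simp add: inner_add_left)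

lemma inner_scale_right:
  assumes "x \<in> hcarrier H" "y \<in> hcarrier H"
  shows "hinner H x (hscale H a y) = cnj a * hinner H x y"
  using assms inner_commute[of x "hscale H a y"] inner_commute[of x y]
  by (simp add: inner_scale_left)

lemma diff_closed [simp]:
  "\<lbrakk>x \<in> hcarrier H; y \<in> hcarrier H\<rbrakk> \<Longrightarrow> hdiff H x y \<in> hcarrier H"
  by (simp add: hdiff_def)

lemma inner_diff_left:
  "\<lbrakk>x \<in> hcarrier H; y \<in> hcarrier H; z \<in> hcarrier H\<rbrakk>
    \<Longrightarrow> hinner H (hdiff H x y) z = hinner H x z - hinner H y z"
  by (simp add: hdiff_def inner_add_left inner_scale_left)

lemma inner_diff_right:
  "\<lbrakk>x \<in> hcarrier H; y \<in> hcarrier H; z \<in> hcarrier H\<rbrakk>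
    \<Longrightarrow> hinner H x (hdiff H y z) = hinner H x y - hinner H x z"
  by (simp add: hdiff_def inner_add_right inner_scale_right)

lemma Re_inner_commute:
  "\<lbrakk>x \<in> hcarrier H; y \<in> hcarrier H\<rbrakk> \<Longrightarrow> Re (hinner H y x) = Re (hinner H x y)"
  using inner_commute[of y x] by simp

lemma inner_self_real: "x \<in> hcarrier H \<Longrightarrow> Im (hinner H x x) = 0"
  using inner_commute[of x x] by (metis cnj.sel(2) neg_equal_zero)

lemma norm_power2: "x \<in> hcarrier H \<Longrightarrow> (hnorm H x)\<^sup>2 = Re (hinner H x x)"
  by (simp add: hnorm_def inner_nonneg)

lemma norm_nonneg [simp]: "x \<in> hcarrier H \<Longrightarrow> 0 \<le> hnorm H x"
  by (simp add: hnorm_def inner_nonneg)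

lemma scale_zero: "x \<in> hcarrier H \<Longrightarrow> hscale H 0 x = hzero H"
  by (rule inner_definite) (simp_all add: inner_scale_left)

lemma inner_zero_left [simp]: "x \<in> hcarrier H \<Longrightarrow> hinner H (hzero H) x = 0"
  using inner_scale_left[of x x 0] by (simp add: scale_zero)

lemma inner_zero_right [simp]: "x \<in> hcarrier H \<Longrightarrow> hinner H x (hzero H) = 0"
  using inner_commute[of x "hzero H"] by simp

lemma scale_of_zero [simp]: "hscale H a (hzero H) = hzero H"
  by (rule inner_definite) (simp_all add: inner_scale_left)

lemma eq_of_diff_zero:
  assumes "x \<in> hcarrier H" "y \<in> hcarrier H" and "hdiff H x y = hzero H"
  shows "x = y"
proof -
  have "hadd H (hscale H (- 1) y) y = hscale H (- 1 + 1) y"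
    using assms by (simp only: scale_add_left scale_one)
  then have "hadd H (hscale H (- 1) y) y = hzero H"
    using assms by (simp add: scale_zero)
  then have "hadd H (hdiff H x y) y = x"
    using assms(1,2) unfolding hdiff_def by (simp add: add_assoc add_zero)
  moreover have "hadd H (hzero H) y = y"
    using assms by (simp add: add_commute[of "hzero H"] add_zero)
  ultimately show ?thesis using assms by simp
qed

lemma eq_of_inner_eq:
  assumes "x \<in> hcarrier H" "y \<in> hcarrier H"
    and "\<And>z. z \<in> hcarrier H \<Longrightarrow> hinner H z x = hinner H z y"
  shows "x = y"
proof (rule eq_of_diff_zero)
  show "hdiff H x y = hzero H"
    using assms(1,2) assms(3)[of "hdiff H x y"]
    by (intro inner_definite) (simp_all add: inner_diff_right)
qed (use assms in auto)

lemma Re_inner_add_scaled: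
  assumes "x \<in> hcarrier H" "y \<in> hcarrier H"
  shows "Re (hinner H (hadd H x (hscale H (of_real t) y)) (hadd H x (hscale H (of_real t) y))) =
    Re (hinner H x x) + 2 * t * Re (hinner H x y) + t\<^sup>2 * Re (hinner H y y)"
  using assms Re_inner_commute[of x y]
  by (simp add: inner_add_left inner_add_right inner_scale_left inner_scale_right
      power2_eq_square algebra_simps)

lemma Re_inner_power2_le:
  assumes "x \<in> hcarrier H" "y \<in> hcarrier H"
  shows "(Re (hinner H x y))\<^sup>2 \<le> Re (hinner H x x) * Re (hinner H y y)"
proof (rule discriminant_nonpos)
  fix t
  show "0 \<le> Re (hinner H x x) + 2 * t * Re (hinner H x y) + t\<^sup>2 * Re (hinner H y y)"
    using assms by (simp add: inner_nonneg flip: Re_inner_add_scaled)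
qed (use assms in \<open>simp add: inner_nonneg\<close>)

lemma Cauchy_Schwarz:
  assumes x: "x \<in> hcarrier H" and y: "y \<in> hcarrier H"
  shows "cmod (hinner H x y) \<le> hnorm H x * hnorm H y"
proof (cases "hinner H x y = 0")
  case True
  then show ?thesis using x y by simp
next
  case False
  define a where "a = hinner H x y"
  define r where "r = (cmod a)\<^sup>2"
  have r: "0 < r" using False by (simp add: r_def a_def)
  have a: "cnj a * a = of_real r"
    using complex_norm_square[of a] by (simp add: r_def mult.commute)
  \<comment> \<open>Rotating \<open>x\<close> by the phase of the inner product makes that product real.\<close>
  have "Re (hinner H (hscale H (cnj a) x) y) = r"
    using x y a by (simp add: inner_scale_left flip: a_def)
  moreover have "Re (hinner H (hscale H (cnj a) x) (hscale H (cnj a) x)) = r * Re (hinner H x x)"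
  proof -
    have "hinner H (hscale H (cnj a) x) (hscale H (cnj a) x) = (cnj a * a) * hinner H x x"
      using x by (simp add: inner_scale_left inner_scale_right)
    then show ?thesis unfolding a by simp
  qed
  ultimately have "r\<^sup>2 \<le> r * Re (hinner H x x) * Re (hinner H y y)"
    using Re_inner_power2_le[of "hscale H (cnj a) x" y] x y by simp
  then have "r \<le> Re (hinner H x x) * Re (hinner H y y)"
    using r by (simp add: power2_eq_square mult.assoc)
  then have "(cmod a)\<^sup>2 \<le> (hnorm H x * hnorm H y)\<^sup>2"
    using x y by (simp add: r_def power_mult_distrib norm_power2)
  then show ?thesis
    unfolding a_def by (rule power2_le_imp_le) (use x y in simp)
qed

text \<open>
  The representing vector of \<open>f\<close> is the minimiser of the functional
  \<open>\<phi> x = \<parallel>x\<parallel>\<^sup>2 - 2 Re (f x)\<close>. A minimising sequence \<open>X\<close> is Cauchy by the parallelogram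
  identity. Moving \<open>X n\<close> in the direction of a vector \<open>h\<close> cannot decrease \<open>\<phi>\<close> by more than the
  excess of \<open>\<phi> (X n)\<close> over the infimum. This is a quadratic inequality, and its discriminant bounds
  the difference of \<open>Re (f h)\<close> and the real part of the inner product of \<open>X n\<close> and \<open>h\<close>, which
  therefore vanishes in the limit.
\<close>

theorem Riesz_representation:
  assumes f_add: "\<And>x y. \<lbrakk>x \<in> hcarrier H; y \<in> hcarrier H\<rbrakk> \<Longrightarrow> f (hadd H x y) = f x + f y"
    and f_scale: "\<And>a x. x \<in> hcarrier H \<Longrightarrow> f (hscale H a x) = a * f x"
    and f_bound: "\<And>x. x \<in> hcarrier H \<Longrightarrow> cmod (f x) \<le> C * hnorm H x"
  shows "\<exists>z\<in>hcarrier H. \<forall>x\<in>hcarrier H. f x = hinner H x z"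
proof -
  define \<phi> where "\<phi> x = Re (hinner H x x) - 2 * Re (f x)" for x
  have lower: "- C\<^sup>2 \<le> \<phi> x" if "x \<in> hcarrier H" for x
  proof -
    have "Re (f x) \<le> C * hnorm H x"
      using f_bound[OF that] complex_Re_le_cmod order_trans by blast
    moreover have "0 \<le> (hnorm H x - C)\<^sup>2" by simp
    ultimately show ?thesis
      using that by (simp add: \<phi>_def norm_power2 power2_diff algebra_simps)
  qed
  define m where "m = Inf (\<phi> ` hcarrier H)"
  have bdd: "bdd_below (\<phi> ` hcarrier H)"
    using lower by (rule bdd_belowI2)
  have m_le: "m \<le> \<phi> x" if "x \<in> hcarrier H" for x
    using bdd that unfolding m_def by (simp add: cInf_lower)
  have "\<exists>x\<in>hcarrier H. \<phi> x < m + inverse (real (Suc n))" for n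
  proof -
    have "Inf (\<phi> ` hcarrier H) < m + inverse (real (Suc n))"
      by (simp add: m_def)
    then show ?thesis
      using zero_closed by (subst (asm) cInf_less_iff[OF _ bdd]) blast+
  qed
  then obtain X where X: "\<And>n. X n \<in> hcarrier H"
    and X_less: "\<And>n. \<phi> (X n) < m + inverse (real (Suc n))"
    by metis
  have dist: "Re (hinner H (hdiff H x y) (hdiff H x y)) \<le> 2 * (\<phi> x - m) + 2 * (\<phi> y - m)"
    if x: "x \<in> hcarrier H" and y: "y \<in> hcarrier H" for x y
  proof -
    let ?w = "hscale H (of_real (1 / 2)) (hadd H x y)"
    have "m \<le> \<phi> ?w" using x y by (simp add: m_le)
    moreover have "\<phi> ?w = (Re (hinner H x x) + 2 * Re (hinner H x y) + Re (hinner H y y)) / 4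
        - (Re (f x) + Re (f y))"
      using x y Re_inner_commute[OF x y] unfolding \<phi>_def
      by (simp add: inner_scale_left inner_scale_right inner_add_left inner_add_right f_add f_scale
          del: of_real_divide) (simp add: field_simps)
    moreover have "Re (hinner H (hdiff H x y) (hdiff H x y)) =
        Re (hinner H x x) - 2 * Re (hinner H x y) + Re (hinner H y y)"
      using x y Re_inner_commute[OF x y] by (simp add: inner_diff_left inner_diff_right)
    ultimately show ?thesis unfolding \<phi>_def[of x] \<phi>_def[of y] by (simp add: field_simps)
  qed
  have excess_tendsto: "(\<lambda>n. \<phi> (X n) - m) \<longlonglongrightarrow> 0"
  proof (rule tendsto_sandwich[OF _ _ tendsto_const LIMSEQ_inverse_real_of_nat])
    show "\<forall>\<^sub>F n in sequentially. 0 \<le> \<phi> (X n) - m"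
      using X by (simp add: m_le)
    show "\<forall>\<^sub>F n in sequentially. \<phi> (X n) - m \<le> inverse (real (Suc n))"
      using less_imp_le[OF X_less] by (simp add: diff_le_eq add.commute)
  qed
  have "\<exists>M. \<forall>i\<ge>M. \<forall>j\<ge>M. hnorm H (hdiff H (X i) (X j)) < e" if e: "0 < e" for e
  proof -
    have "\<forall>\<^sub>F n in sequentially. \<phi> (X n) - m < e\<^sup>2 / 4"
      using excess_tendsto e by (intro order_tendstoD) auto
    then obtain M where M: "\<And>n. n \<ge> M \<Longrightarrow> \<phi> (X n) - m < e\<^sup>2 / 4"
      by (auto simp: eventually_sequentially)
    have "hnorm H (hdiff H (X i) (X j)) < e" if "i \<ge> M" "j \<ge> M" for i j
    proof -
      have "(hnorm H (hdiff H (X i) (X j)))\<^sup>2 < e\<^sup>2"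
        using dist[OF X X, of i j] M[OF that(1)] M[OF that(2)] X by (simp add: norm_power2)
      then show ?thesis by (rule power2_less_imp_less) (use e in simp)
    qed
    then show ?thesis by blast
  qed
  then obtain L where L: "L \<in> hcarrier H"
    and X_lim: "(\<lambda>n. hnorm H (hdiff H (X n) L)) \<longlonglongrightarrow> 0"
    using complete[of X] X by blast
  have Re_eq: "Re (f h) = Re (hinner H L h)" if h: "h \<in> hcarrier H" for h
  proof -
    have variation: "(Re (hinner H (X n) h) - Re (f h))\<^sup>2 \<le> (\<phi> (X n) - m) * Re (hinner H h h)" for n
    proof (rule discriminant_nonpos)
      fix t :: real
      have "m \<le> \<phi> (hadd H (X n) (hscale H (of_real t) h))"
        using X h by (simp add: m_le)
      then show "0 \<le> \<phi> (X n) - m + 2 * t * (Re (hinner H (X n) h) - Re (f h))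
          + t\<^sup>2 * Re (hinner H h h)"
        using X h unfolding \<phi>_def
        by (simp add: Re_inner_add_scaled f_add f_scale) (simp add: algebra_simps)
    qed (use h in \<open>simp add: inner_nonneg\<close>)
    have "(\<lambda>n. (Re (hinner H (X n) h) - Re (f h))\<^sup>2) \<longlonglongrightarrow> 0"
    proof (rule tendsto_sandwich[OF _ _ tendsto_const])
      show "(\<lambda>n. (\<phi> (X n) - m) * Re (hinner H h h)) \<longlonglongrightarrow> 0"
        using tendsto_mult_left_zero[OF excess_tendsto] .
    qed (use variation in auto)
    then have "(\<lambda>n. Re (hinner H (X n) h) - Re (f h)) \<longlonglongrightarrow> 0"
      using tendsto_real_sqrt[of "\<lambda>n. (Re (hinner H (X n) h) - Re (f h))\<^sup>2" 0 sequentially]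
      by (simp add: tendsto_rabs_zero_iff)
    then have 1: "(\<lambda>n. Re (hinner H (X n) h)) \<longlonglongrightarrow> Re (f h)"
      by (simp add: LIM_zero_iff)
    have "(\<lambda>n. hinner H (hdiff H (X n) L) h) \<longlonglongrightarrow> 0"
      by (rule tendsto_0_le[OF X_lim, where K = "hnorm H h"]) (use X L h in \<open>simp add: Cauchy_Schwarz\<close>)
    then have "(\<lambda>n. hinner H (X n) h - hinner H L h) \<longlonglongrightarrow> 0"
      using X L h by (simp add: inner_diff_left)
    then have "(\<lambda>n. hinner H (X n) h) \<longlonglongrightarrow> hinner H L h"
      by (simp add: LIM_zero_iff)
    then have "(\<lambda>n. Re (hinner H (X n) h)) \<longlonglongrightarrow> Re (hinner H L h)"
      by (rule tendsto_Re)
    with 1 show ?thesis by (rule LIMSEQ_unique)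
  qed
  have "f h = hinner H h L" if h: "h \<in> hcarrier H" for h
  proof (rule complex_eqI)
    show "Re (f h) = Re (hinner H h L)"
      using Re_eq[OF h] Re_inner_commute[OF h L] by simp
    \<comment> \<open>The imaginary part of a linear functional at \<open>h\<close> is minus its real part at \<open>\<i> h\<close>.\<close>
    have "Re (f (hscale H \<i> h)) = Re (hinner H (hscale H \<i> h) L)"
      using Re_eq[of "hscale H \<i> h"] Re_inner_commute[OF scale_closed[OF h] L] h by simp
    then show "Im (f h) = Im (hinner H h L)"
      using h L by (simp add: f_scale inner_scale_left)
  qed
  with L show ?thesis by blast
qed

lemma bounded_operatorD:
  assumes "bounded_operator H T"
  shows "x \<in> hcarrier H \<Longrightarrow> T x \<in> hcarrier H"
    and "\<lbrakk>x \<in> hcarrier H; y \<in> hcarrier H\<rbrakk> \<Longrightarrow> T (hadd H x y) = hadd H (T x) (T y)"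
    and "x \<in> hcarrier H \<Longrightarrow> T (hscale H a x) = hscale H a (T x)"
  using assms by (auto simp: bounded_operator_def)

lemma bounded_operator_zero:
  assumes "bounded_operator H T"
  shows "T (hzero H) = hzero H"
  using bounded_operatorD(3)[OF assms zero_closed, of 0] bounded_operatorD(1)[OF assms zero_closed]
  by (simp add: scale_zero)

lemma bounded_operator_bound:
  assumes "bounded_operator H T"
  shows "\<exists>M\<ge>0. \<forall>x\<in>hcarrier H. hnorm H (T x) \<le> M * hnorm H x"
proof -
  obtain M where M: "\<forall>x\<in>hcarrier H. hnorm H (T x) \<le> M * hnorm H x"
    using assms unfolding bounded_operator_def by blast
  have "hnorm H (T x) \<le> \<bar>M\<bar> * hnorm H x" if "x \<in> hcarrier H" for x
    using bspec[OF M that] mult_right_mono[OF abs_ge_self norm_nonneg[OF that], of M] by linarith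
  then show ?thesis using abs_ge_zero by blast
qed

lemma adjoint_op_eqI:
  assumes "z \<in> hcarrier H" and "\<And>x. x \<in> hcarrier H \<Longrightarrow> hinner H (T x) y = hinner H x z"
  shows "adjoint_op H T y = z"
  unfolding adjoint_op_def
proof (rule the_equality)
  show "z \<in> hcarrier H \<and> (\<forall>x\<in>hcarrier H. hinner H (T x) y = hinner H x z)"
    using assms by blast
  show "w = z" if "w \<in> hcarrier H \<and> (\<forall>x\<in>hcarrier H. hinner H (T x) y = hinner H x w)" for w
  proof (rule eq_of_inner_eq)
    show "hinner H x w = hinner H x z" if "x \<in> hcarrier H" for x
      using assms(2)[OF that] \<open>w \<in> _ \<and> _\<close> that by simp
  qed (use assms(1) that in auto)
qed

lemma adjoint_op:
  assumes T: "bounded_operator H T" and y: "y \<in> hcarrier H"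
  shows adjoint_op_closed: "adjoint_op H T y \<in> hcarrier H"
    and inner_adjoint_op: "x \<in> hcarrier H \<Longrightarrow> hinner H (T x) y = hinner H x (adjoint_op H T y)"
proof -
  note D = bounded_operatorD[OF T]
  obtain M where M: "\<forall>x\<in>hcarrier H. hnorm H (T x) \<le> M * hnorm H x"
    using bounded_operator_bound[OF T] by blast
  have "\<exists>z\<in>hcarrier H. \<forall>x\<in>hcarrier H. hinner H (T x) y = hinner H x z"
  proof (rule Riesz_representation)
    fix x assume x: "x \<in> hcarrier H"
    have "cmod (hinner H (T x) y) \<le> hnorm H (T x) * hnorm H y"
      using x y by (simp add: Cauchy_Schwarz D)
    also have "\<dots> \<le> (M * hnorm H x) * hnorm H y"
      using x y M by (intro mult_right_mono) auto
    finally show "cmod (hinner H (T x) y) \<le> (M * hnorm H y) * hnorm H x"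
      by (simp add: mult_ac)
  qed (use y in \<open>simp_all add: D inner_add_left inner_scale_left\<close>)
  then obtain z where z: "z \<in> hcarrier H"
    and eq: "\<And>x. x \<in> hcarrier H \<Longrightarrow> hinner H (T x) y = hinner H x z" by blast
  have "adjoint_op H T y = z"
    using z eq by (rule adjoint_op_eqI)
  with z eq show "adjoint_op H T y \<in> hcarrier H"
    and "x \<in> hcarrier H \<Longrightarrow> hinner H (T x) y = hinner H x (adjoint_op H T y)" by auto
qed

end


section \<open>Diagonal operators on an orthogonal sum\<close>

text \<open>
  The orthogonal sum is presented by its coordinate maps \<open>P p\<close> and not by subspaces of \<open>H\<close>: the
  summands are then spaces in their own right, and an identity in \<open>H\<close> is checked coordinate by
  coordinate.
\<close>

locale orthogonal_sum = hilbert_space H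
  for H :: "'a hspace" +
  fixes l :: nat and G :: "nat \<Rightarrow> 'c hspace" and P :: "nat \<Rightarrow> 'a \<Rightarrow> 'c"
  assumes summand: "p < l \<Longrightarrow> hilbert_space (G p)"
    and coord_closed [simp]: "\<lbrakk>p < l; x \<in> hcarrier H\<rbrakk> \<Longrightarrow> P p x \<in> hcarrier (G p)"
    and coord_add: "\<lbrakk>p < l; x \<in> hcarrier H; y \<in> hcarrier H\<rbrakk>
      \<Longrightarrow> P p (hadd H x y) = hadd (G p) (P p x) (P p y)"
    and coord_scale: "\<lbrakk>p < l; x \<in> hcarrier H\<rbrakk> \<Longrightarrow> P p (hscale H a x) = hscale (G p) a (P p x)"
    and coord_surj: "(\<And>p. p < l \<Longrightarrow> f p \<in> hcarrier (G p))
      \<Longrightarrow> \<exists>x\<in>hcarrier H. \<forall>p<l. P p x = f p"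
    and inner_eq_sum: "\<lbrakk>x \<in> hcarrier H; y \<in> hcarrier H\<rbrakk>
      \<Longrightarrow> hinner H x y = (\<Sum>p<l. hinner (G p) (P p x) (P p y))"
begin

lemma coord_diff:
  "\<lbrakk>p < l; x \<in> hcarrier H; y \<in> hcarrier H\<rbrakk>
    \<Longrightarrow> P p (hdiff H x y) = hdiff (G p) (P p x) (P p y)"
  by (simp add: hdiff_def coord_add coord_scale)

lemma coord_eqI:
  assumes "x \<in> hcarrier H" "y \<in> hcarrier H" and "\<And>p. p < l \<Longrightarrow> P p x = P p y"
  shows "x = y"
  using assms by (intro eq_of_inner_eq) (simp_all add: inner_eq_sum)

lemma norm_power2_eq_sum:
  assumes "x \<in> hcarrier H"
  shows "(hnorm H x)\<^sup>2 = (\<Sum>p<l. (hnorm (G p) (P p x))\<^sup>2)"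
  using assms hilbert_space.norm_power2[OF summand]
  by (simp add: norm_power2 inner_eq_sum Re_sum)

definition assemble :: "(nat \<Rightarrow> 'c) \<Rightarrow> 'a" where
  "assemble y = (SOME x. x \<in> hcarrier H \<and> (\<forall>p<l. P p x = y p))"

lemma assemble:
  assumes "\<And>p. p < l \<Longrightarrow> y p \<in> hcarrier (G p)"
  shows assemble_closed: "assemble y \<in> hcarrier H"
    and coord_assemble: "p < l \<Longrightarrow> P p (assemble y) = y p"
proof -
  have "\<exists>x. x \<in> hcarrier H \<and> (\<forall>p<l. P p x = y p)"
    using coord_surj[of y] assms by blast
  then have "assemble y \<in> hcarrier H \<and> (\<forall>p<l. P p (assemble y) = y p)"
    unfolding assemble_def by (rule someI_ex)
  then show "assemble y \<in> hcarrier H" and "p < l \<Longrightarrow> P p (assemble y) = y p" by auto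
qed

definition embed :: "nat \<Rightarrow> 'c \<Rightarrow> 'a" where
  "embed p y = assemble (\<lambda>q. if q = p then y else hzero (G q))"

lemma embed:
  assumes "p < l" "y \<in> hcarrier (G p)"
  shows embed_closed: "embed p y \<in> hcarrier H"
    and coord_embed: "q < l \<Longrightarrow> P q (embed p y) = (if q = p then y else hzero (G q))"
proof -
  have closed: "(if q = p then y else hzero (G q)) \<in> hcarrier (G q)" if "q < l" for q
    using assms that by (simp add: hilbert_space.zero_closed summand)
  show "embed p y \<in> hcarrier H"
    unfolding embed_def using closed by (rule assemble_closed)
  show "P q (embed p y) = (if q = p then y else hzero (G q))" if "q < l"
    unfolding embed_def using closed that by (rule coord_assemble)
qed

lemma linear_isometry_embed:
  assumes p: "p < l"
  shows "linear_isometry (G p) H (embed p)"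
  unfolding linear_isometry_def
proof (intro conjI ballI allI)
  interpret Gp: hilbert_space "G p" using p by (rule summand)
  fix x y a assume x: "x \<in> hcarrier (G p)"
  show "embed p x \<in> hcarrier H" using p x by (rule embed_closed)
  show "embed p (hscale (G p) a x) = hscale H a (embed p x)"
    using p x
    by (intro coord_eqI)
      (simp_all add: embed_closed coord_embed coord_scale hilbert_space.scale_of_zero summand)
  assume y: "y \<in> hcarrier (G p)"
  show "embed p (hadd (G p) x y) = hadd H (embed p x) (embed p y)"
    using p x y
    by (intro coord_eqI)
      (simp_all add: embed_closed coord_embed coord_add hilbert_space.add_zero
        hilbert_space.zero_closed summand)
  have "hinner H (embed p x) (embed p y) =
      (\<Sum>q<l. hinner (G q) (P q (embed p x)) (P q (embed p y)))"
    using p x y by (simp add: inner_eq_sum embed_closed)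
  also have "\<dots> = (\<Sum>q<l. if q = p then hinner (G p) x y else 0)"
    using p x y
    by (intro sum.cong refl) (simp add: coord_embed hilbert_space.inner_zero_left
        hilbert_space.zero_closed summand)
  finally have "hinner H (embed p x) (embed p y) = (\<Sum>q<l. if q = p then hinner (G p) x y else 0)" .
  then show "hinner H (embed p x) (embed p y) = hinner (G p) x y"
    using p by simp
qed

definition diagonal :: "('a \<Rightarrow> 'a) \<Rightarrow> (nat \<Rightarrow> 'c \<Rightarrow> 'c) \<Rightarrow> bool" where
  "diagonal T D \<longleftrightarrow> (\<forall>x\<in>hcarrier H. T x \<in> hcarrier H \<and> (\<forall>p<l. P p (T x) = D p (P p x)))"

lemma diagonalD:
  assumes "diagonal T D" "x \<in> hcarrier H"
  shows "T x \<in> hcarrier H" and "p < l \<Longrightarrow> P p (T x) = D p (P p x)"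
  using assms by (auto simp: diagonal_def)

lemma diagonal_entry_closed:
  assumes "diagonal T D" "p < l" "y \<in> hcarrier (G p)"
  shows "D p y \<in> hcarrier (G p)"
proof -
  have "P p (T (embed p y)) \<in> hcarrier (G p)"
    using assms(2,3) by (intro coord_closed diagonalD(1)[OF assms(1)] embed_closed)
  then show ?thesis
    using assms by (simp add: diagonalD[OF assms(1)] embed_closed coord_embed)
qed

lemma diagonal_comp:
  "\<lbrakk>diagonal S D; diagonal T E\<rbrakk> \<Longrightarrow> diagonal (\<lambda>x. S (T x)) (\<lambda>p y. D p (E p y))"
  by (simp add: diagonal_def)

lemma diagonal_funpow:
  assumes "diagonal T D"
  shows "diagonal (T ^^ n) (\<lambda>p. D p ^^ n)"
proof (induction n)
  case 0
  show ?case by (simp add: diagonal_def)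
next
  case (Suc n)
  from diagonal_comp[OF assms this] show ?case by (simp add: comp_def)
qed

lemma diagonal_commutator:
  assumes "diagonal S D" "diagonal T E"
  shows "diagonal (commutator H S T) (\<lambda>p. commutator (G p) (D p) (E p))"
  using assms unfolding diagonal_def commutator_def by (simp add: coord_diff)

lemma diagonal_assemble:
  assumes "\<And>p y. \<lbrakk>p < l; y \<in> hcarrier (G p)\<rbrakk> \<Longrightarrow> D p y \<in> hcarrier (G p)"
  shows "diagonal (\<lambda>x. assemble (\<lambda>p. D p (P p x))) D"
  using assms by (simp add: diagonal_def assemble_closed coord_assemble)

lemma bounded_operator_diagonal_iff:
  assumes diag: "diagonal T D"
  shows "bounded_operator H T \<longleftrightarrow> (\<forall>p<l. bounded_operator (G p) (D p))"
proof (intro iffI allI impI)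
  fix p assume T: "bounded_operator H T" and p: "p < l"
  interpret Gp: hilbert_space "G p" using p by (rule summand)
  note J = linear_isometry_embed[OF p, unfolded linear_isometry_def]
  have D_eq: "D p y = P p (T (embed p y))" if "y \<in> hcarrier (G p)" for y
    using p that diagonalD(2)[OF diag embed_closed[OF p that] p] by (simp add: coord_embed)
  obtain M where M: "\<forall>x\<in>hcarrier H. hnorm H (T x) \<le> M * hnorm H x"
    using bounded_operator_bound[OF T] by blast
  show "bounded_operator (G p) (D p)"
    unfolding bounded_operator_def
  proof (intro conjI ballI allI exI)
    fix x y a assume x: "x \<in> hcarrier (G p)"
    show "D p x \<in> hcarrier (G p)" using diag p x by (rule diagonal_entry_closed)
    show "D p (hscale (G p) a x) = hscale (G p) a (D p x)"
      using p x J by (simp add: D_eq bounded_operatorD[OF T] embed_closed coord_scale)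
    have "(hnorm (G p) (D p x))\<^sup>2 \<le> (\<Sum>q<l. (hnorm (G q) (P q (T (embed p x))))\<^sup>2)"
      unfolding D_eq[OF x] using p by (intro member_le_sum) auto
    then have "(hnorm (G p) (D p x))\<^sup>2 \<le> (hnorm H (T (embed p x)))\<^sup>2"
      using p x by (simp add: norm_power2_eq_sum embed_closed bounded_operatorD(1)[OF T])
    then have "hnorm (G p) (D p x) \<le> hnorm H (T (embed p x))"
      by (rule power2_le_imp_le) (use p x in \<open>simp add: embed_closed bounded_operatorD(1)[OF T]\<close>)
    also have "\<dots> \<le> M * hnorm H (embed p x)"
      using M p x by (simp add: embed_closed)
    also have "hnorm H (embed p x) = hnorm (G p) x"
      using J x by (simp add: hnorm_def)
    finally show "hnorm (G p) (D p x) \<le> M * hnorm (G p) x" .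
    assume y: "y \<in> hcarrier (G p)"
    show "D p (hadd (G p) x y) = hadd (G p) (D p x) (D p y)"
      using p x y J by (simp add: D_eq bounded_operatorD[OF T] embed_closed coord_add)
  qed
next
  assume D: "\<forall>p<l. bounded_operator (G p) (D p)"
  note D_bounded = hilbert_space.bounded_operatorD[OF summand D[rule_format]]
  have "\<forall>p. \<exists>M. p < l \<longrightarrow>
      0 \<le> M \<and> (\<forall>y\<in>hcarrier (G p). hnorm (G p) (D p y) \<le> M * hnorm (G p) y)"
    using hilbert_space.bounded_operator_bound[OF summand D[rule_format]] by blast
  from choice[OF this] obtain M where M_nonneg: "\<And>p. p < l \<Longrightarrow> 0 \<le> M p"
    and M: "\<And>p y. \<lbrakk>p < l; y \<in> hcarrier (G p)\<rbrakk> \<Longrightarrow> hnorm (G p) (D p y) \<le> M p * hnorm (G p) y"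
    by blast
  \<comment> \<open>The sum of the squares dominates every single \<open>(M p)\<^sup>2\<close>.\<close>
  define B where "B = (\<Sum>p<l. (M p)\<^sup>2)"
  have B: "0 \<le> B" by (simp add: B_def sum_nonneg)
  show "bounded_operator H T"
    unfolding bounded_operator_def
  proof (intro conjI ballI allI exI)
    fix x y a assume x: "x \<in> hcarrier H"
    note closed = diagonalD(1)[OF diag] and coord = diagonalD(2)[OF diag]
    show "T x \<in> hcarrier H" using x by (rule closed)
    show "T (hscale H a x) = hscale H a (T x)"
      using x by (intro coord_eqI) (simp_all add: closed coord coord_scale D_bounded)
    have "(hnorm (G p) (D p (P p x)))\<^sup>2 \<le> B * (hnorm (G p) (P p x))\<^sup>2" if p: "p < l" for p
    proof -
      interpret Gp: hilbert_space "G p" using p by (rule summand)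
      have "(hnorm (G p) (D p (P p x)))\<^sup>2 \<le> (M p * hnorm (G p) (P p x))\<^sup>2"
        using p x by (intro power_mono M) (simp_all add: D_bounded)
      also have "\<dots> = (M p)\<^sup>2 * (hnorm (G p) (P p x))\<^sup>2"
        by (rule power_mult_distrib)
      also have "\<dots> \<le> B * (hnorm (G p) (P p x))\<^sup>2"
        unfolding B_def using p by (intro mult_right_mono member_le_sum) auto
      finally show ?thesis .
    qed
    then have "(\<Sum>p<l. (hnorm (G p) (D p (P p x)))\<^sup>2) \<le> (\<Sum>p<l. B * (hnorm (G p) (P p x))\<^sup>2)"
      by (intro sum_mono) simp
    then have "(hnorm H (T x))\<^sup>2 \<le> B * (hnorm H x)\<^sup>2"
      using x by (simp add: norm_power2_eq_sum closed coord sum_distrib_left)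
    then have "(hnorm H (T x))\<^sup>2 \<le> (sqrt B * hnorm H x)\<^sup>2"
      using B by (simp add: power_mult_distrib)
    then show "hnorm H (T x) \<le> sqrt B * hnorm H x"
      by (rule power2_le_imp_le) (use B x in simp)
    assume y: "y \<in> hcarrier H"
    show "T (hadd H x y) = hadd H (T x) (T y)"
      using x y by (intro coord_eqI) (simp_all add: closed coord coord_add D_bounded)
  qed
qed

text \<open>
  Assembling the adjoints of the entries gives a vector with the defining property of the adjoint
  of \<open>T\<close>, which determines that adjoint.
\<close>

lemma diagonal_adjoint_op:
  assumes diag: "diagonal T D" and T: "bounded_operator H T"
  shows "diagonal (adjoint_op H T) (\<lambda>p. adjoint_op (G p) (D p))"
  unfolding diagonal_def
proof (intro ballI)
  fix y assume y: "y \<in> hcarrier H"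
  have D: "bounded_operator (G p) (D p)" if "p < l" for p
    using T that bounded_operator_diagonal_iff[OF diag] by simp
  note D_adjoint = hilbert_space.adjoint_op[OF summand D]
  define z where "z = assemble (\<lambda>p. adjoint_op (G p) (D p) (P p y))"
  have z: "z \<in> hcarrier H"
    unfolding z_def using y by (intro assemble_closed) (simp add: D_adjoint)
  have z_coord: "P p z = adjoint_op (G p) (D p) (P p y)" if "p < l" for p
    unfolding z_def using y that by (intro coord_assemble) (simp_all add: D_adjoint)
  have "adjoint_op H T y = z"
  proof (rule adjoint_op_eqI[OF z])
    fix x assume x: "x \<in> hcarrier H"
    have "hinner H (T x) y = (\<Sum>p<l. hinner (G p) (D p (P p x)) (P p y))"
      using x y by (simp add: inner_eq_sum diagonalD[OF diag])
    also have "\<dots> = (\<Sum>p<l. hinner (G p) (P p x) (P p z))"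
      using x y by (intro sum.cong refl) (simp add: z_coord D_adjoint)
    also have "\<dots> = hinner H x z"
      using x z by (simp add: inner_eq_sum)
    finally show "hinner H (T x) y = hinner H x z" .
  qed
  then show "adjoint_op H T y \<in> hcarrier H \<and>
      (\<forall>p<l. P p (adjoint_op H T y) = adjoint_op (G p) (D p) (P p y))"
    using z z_coord by simp
qed

text \<open>
  The quadratic form of a matrix of diagonal operators is the sum of the forms of its entries,
  and families supported in one summand isolate each of these.
\<close>

lemma positive_operator_matrix_diagonal_iff:
  assumes diag: "\<And>i j. \<lbrakk>i \<in> I; j \<in> I\<rbrakk> \<Longrightarrow> diagonal (A i j) (\<lambda>p. D p i j)"
  shows "positive_operator_matrix H I A \<longleftrightarrow> (\<forall>p<l. positive_operator_matrix (G p) I (D p))"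
proof -
  define form where "form p y = (\<Sum>i\<in>I. \<Sum>j\<in>I. hinner (G p) (D p i j (y j)) (y i))" for p y
  have form_sum: "(\<Sum>i\<in>I. \<Sum>j\<in>I. hinner H (A i j (x j)) (x i)) = (\<Sum>p<l. form p (\<lambda>i. P p (x i)))"
    if x: "\<And>i. i \<in> I \<Longrightarrow> x i \<in> hcarrier H" for x
  proof -
    have "(\<Sum>i\<in>I. \<Sum>j\<in>I. hinner H (A i j (x j)) (x i)) =
        (\<Sum>i\<in>I. \<Sum>j\<in>I. \<Sum>p<l. hinner (G p) (D p i j (P p (x j))) (P p (x i)))"
      using x by (intro sum.cong refl) (simp add: inner_eq_sum diagonalD[OF diag])
    also have "\<dots> = (\<Sum>i\<in>I. \<Sum>p<l. \<Sum>j\<in>I. hinner (G p) (D p i j (P p (x j))) (P p (x i)))"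
      by (intro sum.cong refl sum.swap)
    also have "\<dots> = (\<Sum>p<l. form p (\<lambda>i. P p (x i)))"
      unfolding form_def by (rule sum.swap)
    finally show ?thesis .
  qed
  have positive_H: "positive_operator_matrix H I A \<longleftrightarrow>
      (\<forall>x. (\<forall>i\<in>I. x i \<in> hcarrier H) \<longrightarrow>
        (\<Sum>p<l. form p (\<lambda>i. P p (x i))) \<in> \<real> \<and> 0 \<le> Re (\<Sum>p<l. form p (\<lambda>i. P p (x i))))"
    unfolding positive_operator_matrix_def using form_sum by simp
  have positive_G: "positive_operator_matrix (G p) I (D p) \<longleftrightarrow>
      (\<forall>y. (\<forall>i\<in>I. y i \<in> hcarrier (G p)) \<longrightarrow> form p y \<in> \<real> \<and> 0 \<le> Re (form p y))" for p
    unfolding positive_operator_matrix_def form_def ..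
  show ?thesis
  proof (intro iffI allI impI)
    fix p assume pos: "positive_operator_matrix H I A" and p: "p < l"
    show "positive_operator_matrix (G p) I (D p)"
      unfolding positive_G
    proof (intro allI impI)
      fix y assume y: "\<forall>i\<in>I. y i \<in> hcarrier (G p)"
      have other: "form q (\<lambda>i. P q (embed p (y i))) = 0" if q: "q < l" "q \<noteq> p" for q
      proof -
        interpret Gq: hilbert_space "G q" using q(1) by (rule summand)
        have "hinner (G q) (D q i j (P q (embed p (y j)))) (P q (embed p (y i))) = 0"
          if "i \<in> I" "j \<in> I" for i j
          using p y q that diagonal_entry_closed[OF diag[OF that] q(1) Gq.zero_closed]
          by (simp add: coord_embed)
        then show ?thesis by (simp add: form_def)
      qed
      have "form p (\<lambda>i. P p (embed p (y i))) = form p y"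
        unfolding form_def using p y by (intro sum.cong refl) (simp add: coord_embed)
      then have "(\<Sum>q<l. form q (\<lambda>i. P q (embed p (y i)))) = (\<Sum>q<l. if q = p then form p y else 0)"
        using other by (intro sum.cong) auto
      then have "(\<Sum>q<l. form q (\<lambda>i. P q (embed p (y i)))) = form p y"
        using p by simp
      moreover have "\<forall>i\<in>I. embed p (y i) \<in> hcarrier H"
        using p y by (simp add: embed_closed)
      ultimately show "form p y \<in> \<real> \<and> 0 \<le> Re (form p y)"
        using pos[unfolded positive_H, rule_format, of "\<lambda>i. embed p (y i)"] by simp
    qed
  next
    assume pos: "\<forall>p<l. positive_operator_matrix (G p) I (D p)"
    show "positive_operator_matrix H I A"
      unfolding positive_H
    proof (intro allI impI)
      fix x assume x: "\<forall>i\<in>I. x i \<in> hcarrier H"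
      have "form p (\<lambda>i. P p (x i)) \<in> \<real> \<and> 0 \<le> Re (form p (\<lambda>i. P p (x i)))" if "p < l" for p
        using pos[rule_format, OF that, unfolded positive_G] x that by simp
      then show "(\<Sum>p<l. form p (\<lambda>i. P p (x i))) \<in> \<real> \<and> 0 \<le> Re (\<Sum>p<l. form p (\<lambda>i. P p (x i)))"
        by (auto intro: sum_in_Reals sum_nonneg simp: Re_sum)
    qed
  qed
qed

theorem k_hyponormal_diagonal_iff:
  assumes diag: "diagonal T D"
  shows "k_hyponormal H k T \<longleftrightarrow> (\<forall>p<l. k_hyponormal (G p) k (D p))"
proof (cases "bounded_operator H T")
  case True
  have "positive_operator_matrix H {1..k} (\<lambda>i j. commutator H (adjoint_op H T ^^ j) (T ^^ i)) \<longleftrightarrow>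
      (\<forall>p<l. positive_operator_matrix (G p) {1..k}
        (\<lambda>i j. commutator (G p) (adjoint_op (G p) (D p) ^^ j) (D p ^^ i)))"
    by (intro positive_operator_matrix_diagonal_iff diagonal_commutator diagonal_funpow
        diagonal_adjoint_op diag True)
  with True show ?thesis
    by (simp add: k_hyponormal_def bounded_operator_diagonal_iff[OF diag])
next
  case False
  then show ?thesis
    by (auto simp: k_hyponormal_def bounded_operator_diagonal_iff[OF diag])
qed

lemma normal_operator_diagonal:
  assumes diag: "diagonal N D" and normal: "\<And>p. p < l \<Longrightarrow> normal_operator (G p) (D p)"
  shows "normal_operator H N"
proof -
  have N: "bounded_operator H N"
    using normal by (simp add: bounded_operator_diagonal_iff[OF diag] normal_operator_def)
  note adj = diagonal_adjoint_op[OF diag N]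
  have "adjoint_op H N (N x) = N (adjoint_op H N x)" if "x \<in> hcarrier H" for x
    using that normal
    by (intro coord_eqI) (simp_all add: diagonalD[OF diag] diagonalD[OF adj] normal_operator_def)
  with N show ?thesis by (simp add: normal_operator_def)
qed

text \<open>
  Each embedded summand is invariant under \<open>T\<close>, so that a normal extension of \<open>T\<close>, restricted
  along the embedding, extends \<open>D p\<close> as well.
\<close>

lemma embed_diagonal:
  assumes diag: "diagonal T D" and T: "bounded_operator H T"
    and p: "p < l" and y: "y \<in> hcarrier (G p)"
  shows "T (embed p y) = embed p (D p y)"
proof (rule coord_eqI)
  have Dy: "D p y \<in> hcarrier (G p)"
    using diag p y by (rule diagonal_entry_closed)
  show "T (embed p y) \<in> hcarrier H" "embed p (D p y) \<in> hcarrier H"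
    using p y Dy by (simp_all add: embed_closed diagonalD(1)[OF diag])
  fix q assume q: "q < l"
  have "D q (hzero (G q)) = hzero (G q)"
    using T q bounded_operator_diagonal_iff[OF diag]
    by (intro hilbert_space.bounded_operator_zero summand) simp_all
  then show "P q (T (embed p y)) = P q (embed p (D p y))"
    using p q y Dy by (simp add: diagonalD[OF diag] embed_closed coord_embed)
qed

lemma subnormal_diagonal_entry:
  assumes diag: "diagonal T D" and sub: "subnormal TYPE('b) H T" and p: "p < l"
  shows "subnormal TYPE('b) (G p) (D p)"
proof -
  have T: "bounded_operator H T" using sub by (simp add: subnormal_def)
  obtain K :: "'b hspace" and V N where K: "hilbert_space K" and V: "linear_isometry H K V"
    and N: "normal_operator K N" and NV: "\<forall>x\<in>hcarrier H. N (V x) = V (T x)"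
    using sub by (auto simp: subnormal_def)
  have "linear_isometry (G p) K (\<lambda>y. V (embed p y))"
    using V linear_isometry_embed[OF p] by (simp add: linear_isometry_def)
  moreover have "\<forall>y\<in>hcarrier (G p). N (V (embed p y)) = V (embed p (D p y))"
    using NV p by (simp add: embed_closed embed_diagonal[OF diag T])
  moreover have "bounded_operator (G p) (D p)"
    using T p bounded_operator_diagonal_iff[OF diag] by simp
  ultimately show ?thesis
    using K N unfolding subnormal_def by blast
qed

end


section \<open>Orthogonal sums inside a given infinite type\<close>

lemma ex_tuple_encoding:
  assumes inf: "infinite (UNIV :: 'b set)"
  shows "\<exists>e :: (nat \<Rightarrow> 'b) \<Rightarrow> 'b. \<forall>x y. e x = e y \<longleftrightarrow> (\<forall>p<l. x p = y p)"
proof (induction l)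
  case 0
  show ?case by (rule exI[of _ "\<lambda>_. undefined"]) simp
next
  case (Suc l)
  then obtain e :: "(nat \<Rightarrow> 'b) \<Rightarrow> 'b" where e: "\<And>x y. e x = e y \<longleftrightarrow> (\<forall>p<l. x p = y p)"
    by blast
  have "\<exists>h. bij_betw h ((UNIV :: 'b set) \<times> (UNIV :: 'b set)) (UNIV :: 'b set)"
    using inf card_of_Times_same_infinite card_of_ordIso by blast
  then obtain h :: "'b \<times> 'b \<Rightarrow> 'b" where "inj h"
    by (auto simp: bij_betw_def)
  then have "h (e x, x l) = h (e y, y l) \<longleftrightarrow> (\<forall>p<Suc l. x p = y p)" for x y
    by (auto simp: inj_eq e less_Suc_eq)
  then show ?case by (intro exI[of _ "\<lambda>x. h (e x, x l)"]) simp
qed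

text \<open>
  Since an infinite type is equinumerous to its finite powers, a finite orthogonal sum of Hilbert
  spaces with elements of that type can again be realised with elements of that type.
\<close>

theorem ex_orthogonal_sum:
  fixes G :: "nat \<Rightarrow> 'b hspace"
  assumes inf: "infinite (UNIV :: 'b set)" and G: "\<And>p. p < l \<Longrightarrow> hilbert_space (G p)"
  shows "\<exists>(K :: 'b hspace) P. orthogonal_sum K l G P"
proof -
  obtain e :: "(nat \<Rightarrow> 'b) \<Rightarrow> 'b" where e: "\<And>x y. e x = e y \<longleftrightarrow> (\<forall>p<l. x p = y p)"
    using ex_tuple_encoding[OF inf] by blast
  \<comment> \<open>Decoding through an arbitrary preimage: its first \<open>l\<close> entries are determined by the code.\<close>
  define P where "P p b = (SOME x. e x = b) p" for p b
  have P_e: "P p (e x) = x p" if "p < l" for p x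
  proof -
    have "e (SOME y. e y = e x) = e x"
      by (rule someI[where P = "\<lambda>y. e y = e x", OF refl])
    then show ?thesis using that e by (simp add: P_def)
  qed
  define C where "C = e ` {x. \<forall>p<l. x p \<in> hcarrier (G p)}"
  define K where "K = \<lparr>hcarrier = C,
      hzero = e (\<lambda>p. hzero (G p)),
      hadd = (\<lambda>x y. e (\<lambda>p. hadd (G p) (P p x) (P p y))),
      hscale = (\<lambda>a x. e (\<lambda>p. hscale (G p) a (P p x))),
      hinner = (\<lambda>x y. \<Sum>p<l. hinner (G p) (P p x) (P p y))\<rparr>"
  have K_simps [simp]: "hcarrier K = C" "hzero K = e (\<lambda>p. hzero (G p))"
    "hadd K x y = e (\<lambda>p. hadd (G p) (P p x) (P p y))"
    "hscale K a x = e (\<lambda>p. hscale (G p) a (P p x))"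
    "hinner K x y = (\<Sum>p<l. hinner (G p) (P p x) (P p y))" for x y a
    by (simp_all add: K_def)
  note [simp] = P_e
  have e_closed: "e x \<in> C" if "\<And>p. p < l \<Longrightarrow> x p \<in> hcarrier (G p)" for x
    using that by (auto simp: C_def)
  have P_closed: "P p x \<in> hcarrier (G p)" if "p < l" "x \<in> C" for p x
    using that by (auto simp: C_def)
  have C_eqI: "x = y" if "x \<in> C" "y \<in> C" "\<And>p. p < l \<Longrightarrow> P p x = P p y" for x y
    using that by (auto simp: C_def e)
  have e_P: "e f = x" if "x \<in> C" "\<And>p. p < l \<Longrightarrow> f p = P p x" for f x
    using that by (auto simp: C_def e)
  note closed = e_closed P_closed hilbert_space.zero_closed[OF G] hilbert_space.add_closed[OF G]
    hilbert_space.scale_closed[OF G] hilbert_space.diff_closed[OF G]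
  have P_diff: "P p (hdiff K x y) = hdiff (G p) (P p x) (P p y)" if "p < l" for p x y
    using that by (simp add: hdiff_def)
  have diff_closed: "hdiff K x y \<in> C" if "x \<in> C" "y \<in> C" for x y
    using that by (simp add: hdiff_def closed)
  have norm_power2: "(hnorm K x)\<^sup>2 = (\<Sum>p<l. (hnorm (G p) (P p x))\<^sup>2)" if "x \<in> C" for x
    using that
    by (simp add: hnorm_def Re_sum)
      (auto intro!: sum_nonneg sum.cong simp: hilbert_space.inner_nonneg[OF G] closed)
  have norm_nonneg: "0 \<le> hnorm K x" if "x \<in> C" for x
    using that
    by (simp add: hnorm_def Re_sum)
      (auto intro!: sum_nonneg sum.cong simp: hilbert_space.inner_nonneg[OF G] closed)
  have "hilbert_space K"
  proof unfold_locales
    show "hzero K \<in> hcarrier K" by (simp add: closed)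
    fix x y z a b
    assume "x \<in> hcarrier K"
    then have x: "x \<in> C" by simp
    show "hscale K a x \<in> hcarrier K" using x by (simp add: closed)
    show "hadd K x (hzero K) = x"
      using x by (auto intro!: e_P simp: closed hilbert_space.add_zero[OF G])
    show "hscale K (a + b) x = hadd K (hscale K a x) (hscale K b x)"
      using x by (simp add: e closed hilbert_space.scale_add_left[OF G])
    show "hscale K a (hscale K b x) = hscale K (a * b) x"
      using x by (simp add: e closed hilbert_space.scale_scale[OF G])
    show "hscale K 1 x = x"
      using x by (auto intro!: e_P simp: closed hilbert_space.scale_one[OF G])
    show "0 \<le> Re (hinner K x x)"
      using x by (auto intro!: sum_nonneg simp: Re_sum closed hilbert_space.inner_nonneg[OF G])
    show "\<exists>y\<in>hcarrier K. hadd K x y = hzero K"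
    proof
      have "hadd (G p) (P p x) (hscale (G p) (- 1) (P p x)) = hzero (G p)" if p: "p < l" for p
      proof -
        interpret Gp: hilbert_space "G p" using p by (rule G)
        have "hadd (G p) (hscale (G p) 1 (P p x)) (hscale (G p) (- 1) (P p x)) =
            hscale (G p) (1 + - 1) (P p x)"
          using x p by (simp only: Gp.scale_add_left closed)
        then show ?thesis using x p by (simp add: closed Gp.scale_one Gp.scale_zero)
      qed
      then show "hadd K x (hscale K (- 1) x) = hzero K" by (simp add: e)
      show "hscale K (- 1) x \<in> hcarrier K" using x by (simp add: closed)
    qed
    show "x = hzero K" if "hinner K x x = 0"
    proof (rule C_eqI[OF x])
      have nonneg: "0 \<le> Re (hinner (G p) (P p x) (P p x))" if "p < l" for p
        using x that by (simp add: closed hilbert_space.inner_nonneg[OF G])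
      have "(\<Sum>p<l. Re (hinner (G p) (P p x) (P p x))) = 0"
        using that by (simp flip: Re_sum)
      then have Re_zero: "Re (hinner (G p) (P p x) (P p x)) = 0" if "p < l" for p
        using nonneg that by (subst (asm) sum_nonneg_eq_0_iff) auto
      fix p assume p: "p < l"
      interpret Gp: hilbert_space "G p" using p by (rule G)
      have "P p x = hzero (G p)"
        using x p Re_zero[OF p]
        by (intro Gp.inner_definite complex_eqI) (simp_all add: closed Gp.inner_self_real)
      then show "P p x = P p (hzero K)" using p by simp
    qed (simp add: closed)
    assume "y \<in> hcarrier K"
    then have y: "y \<in> C" by simp
    show "hadd K x y \<in> hcarrier K" using x y by (simp add: closed)
    show "hadd K x y = hadd K y x"
      using x y by (simp add: e closed hilbert_space.add_commute[OF G])
    show "hscale K a (hadd K x y) = hadd K (hscale K a x) (hscale K a y)"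
      using x y by (simp add: e closed hilbert_space.scale_add_right[OF G])
    show "hinner K (hscale K a x) y = a * hinner K x y"
      using x y by (simp add: closed hilbert_space.inner_scale_left[OF G] sum_distrib_left)
    show "hinner K x y = cnj (hinner K y x)"
    proof -
      have "hinner (G p) (P p x) (P p y) = cnj (hinner (G p) (P p y) (P p x))" if "p < l" for p
        using x y that by (intro hilbert_space.inner_commute G closed)
      then show ?thesis by (simp add: cnj_sum)
    qed
    assume "z \<in> hcarrier K"
    then have z: "z \<in> C" by simp
    show "hadd K (hadd K x y) z = hadd K x (hadd K y z)"
      using x y z by (simp add: e closed hilbert_space.add_assoc[OF G])
    show "hinner K (hadd K x y) z = hinner K x z + hinner K y z"
      using x y z by (simp add: closed hilbert_space.inner_add_left[OF G] sum.distrib)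
  next
    fix X :: "nat \<Rightarrow> 'b"
    assume "\<And>n. X n \<in> hcarrier K"
    then have X: "X n \<in> C" for n by simp
    assume Cauchy: "\<And>r. 0 < r \<Longrightarrow> \<exists>M. \<forall>m\<ge>M. \<forall>n\<ge>M. hnorm K (hdiff K (X m) (X n)) < r"
    have coord_le: "hnorm (G p) (P p x) \<le> hnorm K x" if p: "p < l" and x: "x \<in> C" for p x
    proof (rule power2_le_imp_le)
      show "(hnorm (G p) (P p x))\<^sup>2 \<le> (hnorm K x)\<^sup>2"
        unfolding norm_power2[OF x] using p by (intro member_le_sum) auto
    qed (use x in \<open>rule norm_nonneg\<close>)
    have "\<exists>y\<in>hcarrier (G p). (\<lambda>n. hnorm (G p) (hdiff (G p) (P p (X n)) y)) \<longlonglongrightarrow> 0"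
      if p: "p < l" for p
    proof (rule hilbert_space.complete[OF G[OF p]])
      show "P p (X n) \<in> hcarrier (G p)" for n
        using p X by (rule P_closed)
      fix r :: real assume "0 < r"
      then obtain M where "\<forall>m\<ge>M. \<forall>n\<ge>M. hnorm K (hdiff K (X m) (X n)) < r"
        using Cauchy by blast
      moreover have "hnorm (G p) (hdiff (G p) (P p (X m)) (P p (X n))) \<le> hnorm K (hdiff K (X m) (X n))"
        for m n
        using coord_le[OF p diff_closed[OF X X], of m n] p by (simp add: P_diff)
      ultimately show
        "\<exists>M. \<forall>m\<ge>M. \<forall>n\<ge>M. hnorm (G p) (hdiff (G p) (P p (X m)) (P p (X n))) < r"
        by (meson le_less_trans)
    qed
    then have "\<forall>p. \<exists>y. p < l \<longrightarrow>
        y \<in> hcarrier (G p) \<and> (\<lambda>n. hnorm (G p) (hdiff (G p) (P p (X n)) y)) \<longlonglongrightarrow> 0"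
      by blast
    from choice[OF this] obtain L where L: "\<And>p. p < l \<Longrightarrow> L p \<in> hcarrier (G p)"
      and lim: "\<And>p. p < l \<Longrightarrow> (\<lambda>n. hnorm (G p) (hdiff (G p) (P p (X n)) (L p))) \<longlonglongrightarrow> 0"
      by blast
    have L_closed: "e L \<in> C" using L by (rule e_closed)
    have "(\<lambda>n. \<Sum>p<l. (hnorm (G p) (hdiff (G p) (P p (X n)) (L p)))\<^sup>2) \<longlonglongrightarrow> (\<Sum>p<l. 0\<^sup>2)"
      by (intro tendsto_sum tendsto_power lim) simp
    then have "(\<lambda>n. (hnorm K (hdiff K (X n) (e L)))\<^sup>2) \<longlonglongrightarrow> 0"
      by (simp add: norm_power2 diff_closed X L_closed P_diff)
    from tendsto_real_sqrt[OF this] have "(\<lambda>n. hnorm K (hdiff K (X n) (e L))) \<longlonglongrightarrow> 0"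
      by (simp add: norm_nonneg diff_closed X L_closed)
    with L_closed show "\<exists>L\<in>hcarrier K. (\<lambda>n. hnorm K (hdiff K (X n) L)) \<longlonglongrightarrow> 0"
      by auto
  qed
  moreover have "orthogonal_sum_axioms K l G P"
  proof (rule orthogonal_sum_axioms.intro)
    show "\<exists>x\<in>hcarrier K. \<forall>p<l. P p x = f p" if "\<And>p. p < l \<Longrightarrow> f p \<in> hcarrier (G p)" for f
      using that by (intro bexI[of _ "e f"]) (simp_all add: closed)
  qed (simp_all add: closed G)
  ultimately show ?thesis
    unfolding orthogonal_sum_def by blast
qed

text \<open>
  Distinct natural multiples of a vector \<open>x \<noteq> 0\<close> have distinct norms, hence distinct images in
  the extension space.
\<close>

lemma infinite_UNIV_of_subnormal:
  assumes H: "hilbert_space H" and sub: "subnormal TYPE('b) H T"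
    and x: "x \<in> hcarrier H" "x \<noteq> hzero H"
  shows "infinite (UNIV :: 'b set)"
proof -
  interpret hilbert_space H by (rule H)
  obtain K :: "'b hspace" and V where V: "linear_isometry H K V"
    using sub by (auto simp: subnormal_def)
  define f where "f n = V (hscale H (of_nat n) x)" for n :: nat
  have "hinner K (V y) (V y) = hinner H y y" if "y \<in> hcarrier H" for y
    using V that by (simp add: linear_isometry_def)
  then have "hinner K (f n) (f n) = of_nat (n\<^sup>2) * hinner H x x" for n
    using x by (simp add: f_def inner_scale_left inner_scale_right power2_eq_square)
  moreover have "hinner H x x \<noteq> 0"
    using x inner_definite by blast
  ultimately have "inj f"
    by (metis injI mult_cancel_right of_nat_eq_iff power2_eq_iff_nonneg zero_le)
  then show ?thesis
    using finite_subset[OF subset_UNIV] finite_imageD infinite_UNIV_nat by blast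
qed

text \<open>
  The sum of normal extensions of the entries is a normal extension of \<open>T\<close>; the infinite type
  has room for the space on which it acts.
\<close>

theorem (in orthogonal_sum) subnormal_diagonal_iff:
  assumes diag: "diagonal T D" and inf: "infinite (UNIV :: 'b set)"
  shows "subnormal TYPE('b) H T \<longleftrightarrow> (\<forall>p<l. subnormal TYPE('b) (G p) (D p))"
proof (intro iffI allI impI)
  show "subnormal TYPE('b) (G p) (D p)" if "subnormal TYPE('b) H T" "p < l" for p
    using diag that by (rule subnormal_diagonal_entry)
next
  assume sub: "\<forall>p<l. subnormal TYPE('b) (G p) (D p)"
  define ext where "ext p K V N \<longleftrightarrow> hilbert_space K \<and> linear_isometry (G p) K V \<and>
      normal_operator K N \<and> (\<forall>x\<in>hcarrier (G p). N (V x) = V (D p x))"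
    for p and K :: "'b hspace" and V N
  have "\<forall>p. \<exists>K V N. p < l \<longrightarrow> ext p K V N"
    using sub unfolding subnormal_def ext_def by blast
  then obtain K V N where KVN: "\<And>p. p < l \<Longrightarrow> ext p (K p) (V p) (N p)"
    by metis
  obtain L :: "'b hspace" and Q where "orthogonal_sum L l K Q"
    using ex_orthogonal_sum[OF inf, of l K] KVN by (auto simp: ext_def)
  then interpret L: orthogonal_sum L l K Q .
  have N_closed: "N p y \<in> hcarrier (K p)" if "p < l" "y \<in> hcarrier (K p)" for p y
    using KVN that by (simp add: ext_def normal_operator_def bounded_operator_def)
  have V_closed: "V p y \<in> hcarrier (K p)" if "p < l" "y \<in> hcarrier (G p)" for p y
    using KVN that by (simp add: ext_def linear_isometry_def)
  have V_scale: "V p (hscale (G p) a y) = hscale (K p) a (V p y)"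
    and NV: "N p (V p y) = V p (D p y)"
    if "p < l" "y \<in> hcarrier (G p)" for p y a
    using KVN[OF that(1)] that(2) unfolding ext_def linear_isometry_def by blast+
  have V_add: "V p (hadd (G p) y z) = hadd (K p) (V p y) (V p z)"
    and V_inner: "hinner (K p) (V p y) (V p z) = hinner (G p) y z"
    if "p < l" "y \<in> hcarrier (G p)" "z \<in> hcarrier (G p)" for p y z
    using KVN[OF that(1)] that(2,3) unfolding ext_def linear_isometry_def by blast+
  define V' where "V' x = L.assemble (\<lambda>p. V p (P p x))" for x
  define N' where "N' x = L.assemble (\<lambda>p. N p (Q p x))" for x
  have N'_diag: "L.diagonal N' N"
    unfolding N'_def using N_closed by (rule L.diagonal_assemble)
  have "normal_operator L N'"
    using N'_diag KVN by (intro L.normal_operator_diagonal) (auto simp: ext_def)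
  moreover have V'_closed: "V' x \<in> hcarrier L" if "x \<in> hcarrier H" for x
    unfolding V'_def using that by (intro L.assemble_closed V_closed) auto
  have V'_coord: "Q p (V' x) = V p (P p x)" if "p < l" "x \<in> hcarrier H" for p x
    unfolding V'_def using that by (intro L.coord_assemble V_closed) auto
  have "linear_isometry H L V'"
    unfolding linear_isometry_def
  proof (intro conjI ballI allI)
    fix x y a assume x: "x \<in> hcarrier H"
    show "V' x \<in> hcarrier L" using x by (rule V'_closed)
    show "V' (hscale H a x) = hscale L a (V' x)"
      by (rule L.coord_eqI) (use x in \<open>simp_all add: V'_closed V'_coord L.coord_scale coord_scale V_scale\<close>)
    assume y: "y \<in> hcarrier H"
    show "V' (hadd H x y) = hadd L (V' x) (V' y)"
      by (rule L.coord_eqI) (use x y in \<open>simp_all add: V'_closed V'_coord L.coord_add coord_add V_add\<close>)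
    show "hinner L (V' x) (V' y) = hinner H x y"
      using x y by (simp add: V'_closed V'_coord L.inner_eq_sum inner_eq_sum V_inner)
  qed
  moreover have "N' (V' x) = V' (T x)" if x: "x \<in> hcarrier H" for x
  proof (rule L.coord_eqI)
    show "Q p (N' (V' x)) = Q p (V' (T x))" if "p < l" for p
      using x that
      by (simp add: V'_closed V'_coord L.diagonalD[OF N'_diag] diagonalD[OF diag] NV)
  qed (use x in \<open>simp_all only: V'_closed L.diagonalD(1)[OF N'_diag] diagonalD(1)[OF diag]\<close>)
  moreover have "bounded_operator H T"
    using sub by (simp add: bounded_operator_diagonal_iff[OF diag] subnormal_def)
  ultimately show "subnormal TYPE('b) H T"
    using L.hilbert_space_axioms unfolding subnormal_def by blast
qed


section \<open>The sequence space as a Hilbert space\<close>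

lemma ell2_simps [simp]:
  "x \<in> hcarrier ell2 \<longleftrightarrow> summable (\<lambda>n. (cmod (x n))\<^sup>2)"
  "hzero ell2 = (\<lambda>n. 0)"
  "hadd ell2 x y = (\<lambda>n. x n + y n)"
  "hscale ell2 a x = (\<lambda>n. a * x n)"
  "hinner ell2 x y = (\<Sum>n. x n * cnj (y n))"
  by (simp_all add: ell2_def)

lemma ell2_diff [simp]: "hdiff ell2 x y = (\<lambda>n. x n - y n)"
  by (simp add: hdiff_def)

lemma summable_inner_ell2:
  assumes "summable (\<lambda>n. (cmod (x n))\<^sup>2)" "summable (\<lambda>n. (cmod (y n))\<^sup>2)"
  shows "summable (\<lambda>n. cmod (x n * cnj (y n)))"
proof (rule summable_comparison_test')
  show "summable (\<lambda>n. (cmod (x n))\<^sup>2 + (cmod (y n))\<^sup>2)"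
    using assms by (rule summable_add)
  show "norm (cmod (x n * cnj (y n))) \<le> (cmod (x n))\<^sup>2 + (cmod (y n))\<^sup>2" for n
    using sum_squares_bound[of "cmod (x n)" "cmod (y n)"]
      mult_nonneg_nonneg[OF norm_ge_zero norm_ge_zero, of "x n" "y n"]
    by (simp only: norm_mult complex_mod_cnj real_norm_def abs_mult abs_norm_cancel)
qed

lemma ell2_add_closed:
  assumes "x \<in> hcarrier ell2" "y \<in> hcarrier ell2"
  shows "hadd ell2 x y \<in> hcarrier ell2"
  unfolding ell2_simps
proof (rule summable_comparison_test')
  show "summable (\<lambda>n. 2 * (cmod (x n))\<^sup>2 + 2 * (cmod (y n))\<^sup>2)"
    using assms by (auto intro: summable_add summable_mult)
  fix n
  have "(cmod (x n + y n))\<^sup>2 \<le> (cmod (x n) + cmod (y n))\<^sup>2"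
    by (intro power_mono norm_triangle_ineq norm_ge_zero)
  also have "\<dots> \<le> 2 * (cmod (x n))\<^sup>2 + 2 * (cmod (y n))\<^sup>2"
    using sum_squares_bound[of "cmod (x n)" "cmod (y n)"] by (simp add: power2_sum)
  finally show "norm ((cmod (x n + y n))\<^sup>2) \<le> 2 * (cmod (x n))\<^sup>2 + 2 * (cmod (y n))\<^sup>2"
    by simp
qed

lemma ell2_scale_closed: "x \<in> hcarrier ell2 \<Longrightarrow> hscale ell2 a x \<in> hcarrier ell2"
  by (simp add: norm_mult power_mult_distrib summable_mult)

lemma ell2_inner_self:
  assumes "x \<in> hcarrier ell2"
  shows "hinner ell2 x x = of_real (\<Sum>n. (cmod (x n))\<^sup>2)"
  using assms by (simp add: suminf_of_real flip: complex_norm_square)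

lemma ell2_norm: "x \<in> hcarrier ell2 \<Longrightarrow> hnorm ell2 x = sqrt (\<Sum>n. (cmod (x n))\<^sup>2)"
  unfolding hnorm_def by (simp only: ell2_inner_self Re_complex_of_real)

lemma cmod_le_ell2_norm:
  assumes "x \<in> hcarrier ell2"
  shows "cmod (x j) \<le> hnorm ell2 x"
proof -
  have "(\<Sum>n\<in>{j}. (cmod (x n))\<^sup>2) \<le> (\<Sum>n. (cmod (x n))\<^sup>2)"
    using assms by (intro sum_le_suminf) auto
  then have "sqrt ((cmod (x j))\<^sup>2) \<le> hnorm ell2 x"
    unfolding ell2_norm[OF assms] by (intro real_sqrt_le_mono) simp
  then show ?thesis by simp
qed

text \<open>
  The coordinatewise limit of a Cauchy sequence is its limit in norm: the Cauchy estimate passes to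
  the limit on every finite set of coordinates, uniformly in the set.
\<close>

lemma ell2_complete:
  assumes X: "\<And>n. X n \<in> hcarrier ell2"
    and Cauchy: "\<And>e. 0 < e \<Longrightarrow> \<exists>M::nat. \<forall>m\<ge>M. \<forall>n\<ge>M. hnorm ell2 (hdiff ell2 (X m) (X n)) < e"
  shows "\<exists>L\<in>hcarrier ell2. (\<lambda>n. hnorm ell2 (hdiff ell2 (X n) L)) \<longlonglongrightarrow> 0"
proof -
  have diff_closed: "hdiff ell2 x y \<in> hcarrier ell2"
    if "x \<in> hcarrier ell2" "y \<in> hcarrier ell2" for x y
    unfolding hdiff_def using that by (intro ell2_add_closed ell2_scale_closed)
  have "Cauchy (\<lambda>n. X n j)" for j
  proof (rule CauchyI)
    fix e :: real assume "0 < e"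
    then obtain M where "\<forall>m\<ge>M. \<forall>n\<ge>M. hnorm ell2 (hdiff ell2 (X m) (X n)) < e"
      using Cauchy by blast
    moreover have "cmod (X m j - X n j) \<le> hnorm ell2 (hdiff ell2 (X m) (X n))" for m n
      using cmod_le_ell2_norm[OF diff_closed[OF X X], of m n j] by simp
    ultimately show "\<exists>M. \<forall>m\<ge>M. \<forall>n\<ge>M. cmod (X m j - X n j) < e"
      by (meson le_less_trans)
  qed
  then have "\<forall>j. \<exists>a. (\<lambda>n. X n j) \<longlonglongrightarrow> a"
    by (simp add: Cauchy_convergent_iff convergent_def)
  then obtain L where lim: "\<And>j. (\<lambda>n. X n j) \<longlonglongrightarrow> L j"
    by metis
  have tail: "\<exists>M. \<forall>m\<ge>M. hdiff ell2 (X m) L \<in> hcarrier ell2 \<and> hnorm ell2 (hdiff ell2 (X m) L) \<le> e"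
    if e: "0 < e" for e
  proof -
    obtain M where M: "\<And>m n. \<lbrakk>m \<ge> M; n \<ge> M\<rbrakk> \<Longrightarrow> hnorm ell2 (hdiff ell2 (X m) (X n)) < e"
      using Cauchy[OF e] by blast
    have "hdiff ell2 (X m) L \<in> hcarrier ell2 \<and> hnorm ell2 (hdiff ell2 (X m) L) \<le> e"
      if m: "m \<ge> M" for m
    proof -
      have partial: "(\<Sum>j<N. (cmod (X m j - L j))\<^sup>2) \<le> e\<^sup>2" for N
      proof (rule LIMSEQ_le_const2)
        show "(\<lambda>n. \<Sum>j<N. (cmod (X m j - X n j))\<^sup>2) \<longlonglongrightarrow> (\<Sum>j<N. (cmod (X m j - L j))\<^sup>2)"
          by (intro tendsto_intros lim)
        have "(\<Sum>j<N. (cmod (X m j - X n j))\<^sup>2) \<le> e\<^sup>2" if n: "n \<ge> M" for n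
        proof -
          have sm: "summable (\<lambda>j. (cmod (X m j - X n j))\<^sup>2)"
            using diff_closed[OF X X, of m n] by simp
          then have "(\<Sum>j<N. (cmod (X m j - X n j))\<^sup>2) \<le> (\<Sum>j. (cmod (X m j - X n j))\<^sup>2)"
            by (intro sum_le_suminf) auto
          also have "\<dots> = (hnorm ell2 (hdiff ell2 (X m) (X n)))\<^sup>2"
            using sm by (simp add: ell2_norm suminf_nonneg)
          also have "\<dots> \<le> e\<^sup>2"
          proof (rule power_mono)
            show "hnorm ell2 (hdiff ell2 (X m) (X n)) \<le> e" using M[OF m n] by simp
            show "0 \<le> hnorm ell2 (hdiff ell2 (X m) (X n))"
              using sm by (simp add: ell2_norm suminf_nonneg)
          qed
          finally show ?thesis .
        qed
        then show "\<exists>M. \<forall>n\<ge>M. (\<Sum>j<N. (cmod (X m j - X n j))\<^sup>2) \<le> e\<^sup>2" by blast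
      qed
      have sm: "summable (\<lambda>j. (cmod (X m j - L j))\<^sup>2)"
        by (rule summableI_nonneg_bounded[OF _ partial]) simp
      have "(\<Sum>j. (cmod (X m j - L j))\<^sup>2) \<le> e\<^sup>2"
        using sm partial by (intro suminf_le_const)
      then have "hnorm ell2 (hdiff ell2 (X m) L) \<le> e"
        using sm e by (simp add: ell2_norm real_le_lsqrt suminf_nonneg)
      with sm show ?thesis by simp
    qed
    then show ?thesis by blast
  qed
  obtain m where m: "hdiff ell2 (X m) L \<in> hcarrier ell2"
    using tail[of 1] by auto
  have "L \<in> hcarrier ell2"
    using diff_closed[OF X m, of m] by simp
  moreover have "(\<lambda>n. hnorm ell2 (hdiff ell2 (X n) L)) \<longlonglongrightarrow> 0"
  proof (rule LIMSEQ_I)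
    fix r :: real assume "0 < r"
    then obtain M where M: "\<forall>m\<ge>M. hdiff ell2 (X m) L \<in> hcarrier ell2 \<and>
        hnorm ell2 (hdiff ell2 (X m) L) \<le> r / 2"
      using tail[of "r / 2"] by auto
    have "norm (hnorm ell2 (hdiff ell2 (X m) L) - 0) < r" if "m \<ge> M" for m
    proof -
      have in_ell2: "hdiff ell2 (X m) L \<in> hcarrier ell2" using M that by blast
      have "0 \<le> hnorm ell2 (hdiff ell2 (X m) L)"
        using in_ell2 cmod_le_ell2_norm[OF in_ell2, of 0] norm_ge_zero order_trans by blast
      then show ?thesis
        using M that \<open>0 < r\<close> by (auto dest!: spec[of _ m])
    qed
    then show "\<exists>M. \<forall>n\<ge>M. norm (hnorm ell2 (hdiff ell2 (X n) L) - 0) < r" by blast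
  qed
  ultimately show ?thesis by blast
qed

theorem hilbert_space_ell2: "hilbert_space ell2"
proof (rule hilbert_space.intro)
  note summable = summable_norm_cancel[OF summable_inner_ell2]
  fix x y z :: "nat \<Rightarrow> complex" and a
  assume x: "x \<in> hcarrier ell2"
  show "hscale ell2 a x \<in> hcarrier ell2" using x by (rule ell2_scale_closed)
  show "\<exists>y\<in>hcarrier ell2. hadd ell2 x y = hzero ell2"
    using x by (intro bexI[of _ "\<lambda>n. - x n"]) simp_all
  show "0 \<le> Re (hinner ell2 x x)"
    using x unfolding ell2_inner_self[OF x] by (simp add: suminf_nonneg)
  show "x = hzero ell2" if "hinner ell2 x x = 0"
    using x that unfolding ell2_inner_self[OF x] by (simp add: suminf_eq_zero_iff fun_eq_iff)
  assume y: "y \<in> hcarrier ell2"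
  show "hadd ell2 x y \<in> hcarrier ell2" using x y by (rule ell2_add_closed)
  show "hinner ell2 (hscale ell2 a x) y = a * hinner ell2 x y"
    using summable[of x y] x y by (simp add: mult.assoc suminf_mult)
  have "(\<lambda>n. y n * cnj (x n)) sums hinner ell2 y x"
    using summable[of y x] x y by (simp add: summable_sums)
  then have "(\<lambda>n. cnj (y n * cnj (x n))) sums cnj (hinner ell2 y x)"
    by (simp only: sums_cnj)
  then show "hinner ell2 x y = cnj (hinner ell2 y x)"
    by (simp add: sums_iff mult.commute)
  assume z: "z \<in> hcarrier ell2"
  show "hinner ell2 (hadd ell2 x y) z = hinner ell2 x z + hinner ell2 y z"
    using summable[of x z] summable[of y z] x y z by (simp add: distrib_right suminf_add)
next
  show "\<exists>L\<in>hcarrier ell2. (\<lambda>n. hnorm ell2 (hdiff ell2 (X n) L)) \<longlonglongrightarrow> 0"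
    if "\<And>n. X n \<in> hcarrier ell2"
      "\<And>e. 0 < e \<Longrightarrow> \<exists>M::nat. \<forall>m\<ge>M. \<forall>n\<ge>M. hnorm ell2 (hdiff ell2 (X m) (X n)) < e" for X
    using that by (rule ell2_complete)
qed (simp_all add: algebra_simps)


section \<open>Splitting a sequence into residue classes\<close>

text \<open>
  With \<open>p < l\<close>, the sequence along the residue class of \<open>p\<close> modulo \<open>l\<close>; these are the
  coordinates that make \<open>\<ell>\<^sup>2\<close> an orthogonal sum of \<open>l\<close> copies of itself.
\<close>

definition subsequence :: "nat \<Rightarrow> nat \<Rightarrow> (nat \<Rightarrow> 'a) \<Rightarrow> nat \<Rightarrow> 'a" where
  "subsequence l p x j = x (l * j + p)"

lemma sum_packet:
  fixes f :: "nat \<Rightarrow> 'a :: comm_monoid_add"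
  shows "sum f {n * l..<n * l + l} = (\<Sum>p<l. subsequence l p f n)"
  unfolding subsequence_def
  by (rule sum.reindex_bij_witness[of _ "\<lambda>p. l * n + p" "\<lambda>i. i - l * n"]) (auto simp: mult.commute)

lemma summable_subsequence:
  fixes f :: "nat \<Rightarrow> real"
  assumes "0 < l" "summable f" "\<And>n. 0 \<le> f n"
  shows "summable (subsequence l p f)"
proof -
  have "inj (\<lambda>j. l * j + p)" using assms(1) by (auto intro: injI)
  from summable_reindex[OF assms(2) this assms(3)] show ?thesis
    by (simp add: comp_def subsequence_def[abs_def])
qed

lemma suminf_subsequence:
  fixes f :: "nat \<Rightarrow> complex"
  assumes l: "0 < l" and f: "summable (\<lambda>n. cmod (f n))"
  shows "suminf f = (\<Sum>p<l. suminf (subsequence l p f))"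
proof -
  have summable: "summable (subsequence l p f)" for p
    by (rule summable_norm_cancel)
      (use summable_subsequence[OF l f, of p] in \<open>simp add: subsequence_def[abs_def]\<close>)
  have "(\<lambda>n. sum f {n * l..<n * l + l}) sums suminf f"
    using summable_norm_cancel[OF f] l by (intro sums_group) auto
  then have "suminf f = (\<Sum>n. \<Sum>p<l. subsequence l p f n)"
    by (simp add: sum_packet sums_iff)
  also have "\<dots> = (\<Sum>p<l. suminf (subsequence l p f))"
    using summable by (intro suminf_sum)
  finally show ?thesis .
qed

lemma interleave_in_ell2:
  assumes l: "0 < l" and f: "\<And>p. p < l \<Longrightarrow> f p \<in> hcarrier ell2"
  shows "(\<lambda>n. f (n mod l) (n div l)) \<in> hcarrier ell2"
proof -
  define g where "g n = (cmod (f (n mod l) (n div l)))\<^sup>2" for n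
  have "summable g"
  proof (rule summableI_nonneg_bounded)
    fix N
    have "sum g {..<N} \<le> sum g {..<N * l}"
      using l by (intro sum_mono2) (auto simp: g_def intro: less_le_trans)
    also have "\<dots> = (\<Sum>n<N. \<Sum>p<l. (cmod (f p n))\<^sup>2)"
      unfolding sum_packet sum.nat_group[symmetric]
      using l by (intro sum.cong refl) (simp add: g_def subsequence_def)
    also have "\<dots> = (\<Sum>p<l. \<Sum>n<N. (cmod (f p n))\<^sup>2)"
      by (rule sum.swap)
    also have "\<dots> \<le> (\<Sum>p<l. \<Sum>n. (cmod (f p n))\<^sup>2)"
      using f by (intro sum_mono sum_le_suminf) auto
    finally show "sum g {..<N} \<le> (\<Sum>p<l. \<Sum>n. (cmod (f p n))\<^sup>2)" .
  qed (simp add: g_def)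
  then show ?thesis by (simp add: g_def[abs_def])
qed

theorem orthogonal_sum_ell2_subsequence:
  assumes l: "0 < l"
  shows "orthogonal_sum ell2 l (\<lambda>_. ell2) (subsequence l)"
proof (intro orthogonal_sum.intro orthogonal_sum_axioms.intro hilbert_space_ell2)
  fix p x y a
  assume x: "x \<in> hcarrier ell2"
  have "summable (subsequence l p (\<lambda>n. (cmod (x n))\<^sup>2))"
    using l x by (intro summable_subsequence) auto
  then show "subsequence l p x \<in> hcarrier ell2"
    by (simp add: subsequence_def[abs_def])
  show "subsequence l p (hscale ell2 a x) = hscale ell2 a (subsequence l p x)"
    by (simp add: subsequence_def[abs_def])
  assume y: "y \<in> hcarrier ell2"
  show "subsequence l p (hadd ell2 x y) = hadd ell2 (subsequence l p x) (subsequence l p y)"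
    by (simp add: subsequence_def[abs_def])
  have "(\<Sum>n. x n * cnj (y n)) = (\<Sum>p<l. suminf (subsequence l p (\<lambda>n. x n * cnj (y n))))"
    using l x y by (intro suminf_subsequence summable_inner_ell2) auto
  then show "hinner ell2 x y = (\<Sum>p<l. hinner ell2 (subsequence l p x) (subsequence l p y))"
    by (simp add: subsequence_def[abs_def])
next
  fix f :: "nat \<Rightarrow> nat \<Rightarrow> complex"
  assume "\<And>p. p < l \<Longrightarrow> f p \<in> hcarrier ell2"
  with l show "\<exists>x\<in>hcarrier ell2. \<forall>p<l. subsequence l p x = f p"
    by (intro bexI[of _ "\<lambda>n. f (n mod l) (n div l)"] interleave_in_ell2)
      (simp_all add: subsequence_def fun_eq_iff)
qed


section \<open>Powers of weighted shifts\<close>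

lemma weighted_shift_simps [simp]:
  "weighted_shift \<alpha> x 0 = 0"
  "weighted_shift \<alpha> x (Suc m) = of_real (\<alpha> m) * x m"
  by (simp_all add: weighted_shift_def)

lemma weighted_shift_in_ell2:
  assumes "weight_sequence \<alpha>" and x: "x \<in> hcarrier ell2"
  shows "weighted_shift \<alpha> x \<in> hcarrier ell2"
proof -
  obtain B where B: "\<And>n. \<bar>\<alpha> n\<bar> \<le> B"
    using assms(1) by (auto simp: weight_sequence_def Bseq_def)
  have "summable (\<lambda>n. (cmod (weighted_shift \<alpha> x (Suc n)))\<^sup>2)"
  proof (rule summable_comparison_test')
    show "summable (\<lambda>n. B\<^sup>2 * (cmod (x n))\<^sup>2)"
      using x by (simp add: summable_mult)
    show "norm ((cmod (weighted_shift \<alpha> x (Suc n)))\<^sup>2) \<le> B\<^sup>2 * (cmod (x n))\<^sup>2" for n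
      using power_mono[OF B, of n 2]
      by (simp add: norm_mult power_mult_distrib mult_right_mono)
  qed
  then have "summable (\<lambda>n. (cmod (weighted_shift \<alpha> x n))\<^sup>2)"
    by (subst (asm) summable_Suc_iff)
  then show ?thesis by simp
qed

lemma weighted_shift_funpow:
  "(weighted_shift \<alpha> ^^ r) x n =
    (if n < r then 0 else of_real (\<Prod>m<r. \<alpha> (n - r + m)) * x (n - r))"
proof (induction r arbitrary: n)
  case (Suc r)
  show ?case
    by (cases n) (simp_all add: Suc.IH)
qed simp

text \<open>
  A step by \<open>l\<close> stays in its residue class, where it is a step by one, and collects the weights
  of one packet. The initial \<open>0\<close> of the shifted subsequence is the entry at \<open>p < l\<close>, which lies
  among the \<open>l\<close> zeros produced by the power.
\<close>

lemma subsequence_weighted_shift_funpow: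
  assumes "p < l"
  shows "subsequence l p ((weighted_shift \<alpha> ^^ l) x) =
    weighted_shift (packet_weights \<alpha> l p) (subsequence l p x)"
proof
  fix j
  show "subsequence l p ((weighted_shift \<alpha> ^^ l) x) j =
      weighted_shift (packet_weights \<alpha> l p) (subsequence l p x) j"
    using assms
    by (cases j)
      (simp_all add: subsequence_def weighted_shift_funpow packet_weights_def)
qed

theorem corollary2p8:
  fixes \<alpha> :: "nat \<Rightarrow> real" and l k :: nat
  assumes "weight_sequence \<alpha>" and "l \<ge> 1" and "k \<ge> 1"
  shows "(k_hyponormal ell2 k (weighted_shift \<alpha> ^^ l) \<longleftrightarrow>
            (\<forall>i<l. k_hyponormal ell2 k (weighted_shift (packet_weights \<alpha> l i)))) \<and>
         (subnormal TYPE('b) ell2 (weighted_shift \<alpha> ^^ l) \<longleftrightarrow>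
            (\<forall>i<l. subnormal TYPE('b) ell2 (weighted_shift (packet_weights \<alpha> l i))))"
proof -
  interpret orthogonal_sum ell2 l "\<lambda>_. ell2" "subsequence l"
    using assms(2) by (intro orthogonal_sum_ell2_subsequence) simp
  have "(weighted_shift \<alpha> ^^ r) x \<in> hcarrier ell2" if "x \<in> hcarrier ell2" for r x
    using that by (induction r) (simp_all del: ell2_simps add: weighted_shift_in_ell2[OF assms(1)])
  then have diag: "diagonal (weighted_shift \<alpha> ^^ l) (\<lambda>i. weighted_shift (packet_weights \<alpha> l i))"
    unfolding diagonal_def by (blast intro: subsequence_weighted_shift_funpow)
  define e :: "nat \<Rightarrow> complex" where "e n = (if n = 0 then 1 else 0)" for n
  have e: "e \<in> hcarrier ell2" "e \<noteq> hzero ell2"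
    by (auto simp: e_def fun_eq_iff intro!: summable_finite[of "{0}"] split: if_splits)
  have infinite: "infinite (UNIV :: 'b set)" if "subnormal TYPE('b) ell2 T" for T
    using hilbert_space_ell2 that e by (rule infinite_UNIV_of_subnormal)
  have "subnormal TYPE('b) ell2 (weighted_shift \<alpha> ^^ l) \<longleftrightarrow>
      (\<forall>i<l. subnormal TYPE('b) ell2 (weighted_shift (packet_weights \<alpha> l i)))"
  proof (cases "infinite (UNIV :: 'b set)")
    case True
    then show ?thesis by (rule subnormal_diagonal_iff[OF diag])
  next
    case False
    with infinite assms(2) show ?thesis by (auto intro: exI[of _ 0])
  qed
  with k_hyponormal_diagonal_iff[OF diag] show ?thesis by simp
qed

end
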